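(* Let $\mathscr{A}$ be a Poisson $C^\infty$-ring. Then the structure sheaf $\mathscr{O}_{\mathscr{A}}$ of the affine $C^\infty$-scheme $\mathrm{Spec}(\mathscr{A}) = (X_{\mathscr{A}}, \mathscr{O}_{\mathscr{A}})$ is a sheaf of Poisson $C^\infty$-rings. That is, $\mathrm{Spec}(\mathscr{A})$ is a Poisson $C^\infty$-scheme.
   Context: A $C^\infty$-ring is a product preserving functor from the category of spaces $\mathbb{R}^n$ ($n\ge 0$) and smooth maps to sets; equivalently, a set $\mathscr{A}$ with an operation $f_{\mathscr{A}}:\mathscr{A}^n\to\mathscr{A}$ for each $n\geq 0$ and each $f\in C^\infty(\mathbb{R}^n)$, compatible with composition of smooth functions and sending coordinate functions to projections. It has an underlying commutative unital $\mathbb{R}$-algebra. Maps of $C^\infty$-rings are functions preserving all operations. A Poisson $C^\infty$-ring is a $C^\infty$-ring $\mathscr{A}$ with a Poisson bracket $\{\cdot,\cdot\}:\mathscr{A}\times\mathscr{A}\to\mathscr{A}$ on the underlying $\mathbb{R}$-algebra (a Lie bracket that is an $\mathbb{R}$-algebra derivation in each slot) such that for each $a\in\mathscr{A}$ the map $\{a,\cdot\}$ is a $C^\infty$-ring derivation: $\{a, f_{\mathscr{A}}(a_1,\ldots,a_n)\} = \sum_{i=1}^n (\partial_i f)_{\mathscr{A}}(a_1,\ldots,a_n)\cdot\{a,a_i\}$ for all $n>0$, $f\in C^\infty(\mathbb{R}^n)$, $a_1,\dots,a_n\in\mathscr{A}$. A map of Poisson $C^\infty$-rings is a map of $C^\infty$-rings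 preserving the brackets. A sheaf $\mathscr{O}$ of $C^\infty$-rings on a space $X$ is a sheaf of Poisson $C^\infty$-rings if $\mathscr{O}(U)$ is a Poisson $C^\infty$-ring for every open $U\subset X$ and the restriction maps are maps of Poisson $C^\infty$-rings. Construction of $\mathrm{Spec}(\mathscr{A})$ for a $C^\infty$-ring $\mathscr{A}$. The set of $\mathbb{R}$-points is $X_{\mathscr{A}} = \mathrm{Hom}(\mathscr{A},\mathbb{R})$, the set of $C^\infty$-ring maps $\mathscr{A}\to\mathbb{R}$, with the topology having as a basis the sets $U_a=\{x\in X_{\mathscr{A}}\mid x(a)\neq 0\}$, $a\in\mathscr{A}$. For $x\in X_{\mathscr{A}}$ let $\pi_x:\mathscr{A}\to\mathscr{A}_x$ be the localization of the $C^\infty$-ring $\mathscr{A}$ at the set $\{a\in\mathscr{A}\mid x(a)\ne 0\}$ (the universal $C^\infty$-ring map making these elements invertible); $\pi_x$ is surjective with kernel $I_x=\{a\in\mathscr{A}\mid \exists\, d\in\mathscr{A},\ x(d)\neq 0,\ ad=0\}$, so $\mathscr{A}_x\simeq\mathscr{A}/I_x$. For $a\in\mathscr{A}$ let $\mathfrak{s}_a: X_{\mathscr{A}}\to\bigsqcup_{x\in X_{\mathscr{A}}}\mathscr{A}_x$, $\mathfrak{s}_a(x)=\pi_x(a)$. For $U\subset X_{\mathscr{A}}$ open, $\mathscr{O}_{\mathscr{A}}(U)$ is the set of all $s:U\to\bigsqcup_{x\in U}\mathscr{A}_x$ such that there are an open cover $\{U_\alpha\}$ of $U$ and elements $a_\alpha\in\mathscr{A}$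 with $s|_{U_\alpha}=\mathfrak{s}_{a_\alpha}|_{U_\alpha}$ for all $\alpha$, with pointwise $C^\infty$-ring operations. The pair $(X_{\mathscr{A}},\mathscr{O}_{\mathscr{A}})$ is a local $C^\infty$-ringed space (a space with a sheaf of $C^\infty$-rings each of whose stalks is local, i.e. has a unique $\mathbb{R}$-point). It is a Poisson $C^\infty$-scheme when $\mathscr{O}_{\mathscr{A}}$ is a sheaf of Poisson $C^\infty$-rings. *)

theory Defs
  imports "HOL-Analysis.Analysis" "HOL-Algebra.Module"
begin

section \<open>Smooth functions of n real variables\<close>

text \<open>
  The number of variables of a smooth function varies inside the axioms of a \<open>C\<^sup>\<infinity>\<close>-ring, so
  \<open>\<real>\<^sup>n\<close> cannot be a type indexed by its dimension. A function on \<open>\<real>\<^sup>n\<close> is represented by its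
  pullback along the projection of \<open>nat \<Rightarrow> real\<close> onto the coordinates \<open>0, \<dots>, n - 1\<close>, that is,
  by a function on \<open>nat \<Rightarrow> real\<close> that does not depend on the other coordinates. For such
  functions, continuity in the product topology of \<open>nat \<Rightarrow> real\<close> is continuity on \<open>\<real>\<^sup>n\<close>.
\<close>

definition partial :: "nat \<Rightarrow> ((nat \<Rightarrow> real) \<Rightarrow> real) \<Rightarrow> (nat \<Rightarrow> real) \<Rightarrow> real" where
  "partial i f = (\<lambda>x. deriv (\<lambda>t. f (x(i := t))) (x i))"

fun Ck :: "nat \<Rightarrow> nat \<Rightarrow> ((nat \<Rightarrow> real) \<Rightarrow> real) \<Rightarrow> bool" where
  "Ck n 0 f \<longleftrightarrow> continuous_on UNIV f"
| "Ck n (Suc k) f \<longleftrightarrow> continuous_on UNIV f \<and>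
     (\<forall>i<n. (\<forall>x. (\<lambda>t. f (x(i := t))) differentiable (at (x i))) \<and> Ck n k (partial i f))"

definition Cinf :: "nat \<Rightarrow> ((nat \<Rightarrow> real) \<Rightarrow> real) set" where
  "Cinf n = {f. (\<forall>x y. (\<forall>i<n. x i = y i) \<longrightarrow> f x = f y) \<and> (\<forall>k. Ck n k f)}"


section \<open>\<open>C\<^sup>\<infinity>\<close>-rings\<close>

text \<open>
  \<open>oper A n f\<close> is the operation \<open>A\<^sup>n \<rightarrow> A\<close> attached to \<open>f \<in> C\<^sup>\<infinity>(\<real>\<^sup>n)\<close>. A tuple in \<open>A\<^sup>n\<close> is given by
  a function on \<open>nat\<close> of which only the values at \<open>0, \<dots>, n - 1\<close> matter (axiom \<open>oper_cong\<close>).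
\<close>

record 'a cinf_ring = "'a partial_object" +
  oper :: "nat \<Rightarrow> ((nat \<Rightarrow> real) \<Rightarrow> real) \<Rightarrow> (nat \<Rightarrow> 'a) \<Rightarrow> 'a"

locale cinf_ring =
  fixes A :: "'a cinf_ring"
  assumes oper_closed:
      "\<lbrakk>f \<in> Cinf n; a \<in> {..<n} \<rightarrow> carrier A\<rbrakk> \<Longrightarrow> oper A n f a \<in> carrier A"
    and oper_cong:
      "\<lbrakk>f \<in> Cinf n; a \<in> {..<n} \<rightarrow> carrier A; \<And>i. i < n \<Longrightarrow> a i = b i\<rbrakk>
        \<Longrightarrow> oper A n f a = oper A n f b"
    and oper_proj:
      "\<lbrakk>i < n; a \<in> {..<n} \<rightarrow> carrier A\<rbrakk> \<Longrightarrow> oper A n (\<lambda>v. v i) a = a i"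
    and oper_comp:
      "\<lbrakk>f \<in> Cinf m; \<And>j. j < m \<Longrightarrow> g j \<in> Cinf n; a \<in> {..<n} \<rightarrow> carrier A\<rbrakk>
        \<Longrightarrow> oper A n (\<lambda>v. f (\<lambda>j. g j v)) a = oper A m f (\<lambda>j. oper A n (g j) a)"

definition cinf_hom :: "'a cinf_ring \<Rightarrow> 'b cinf_ring \<Rightarrow> ('a \<Rightarrow> 'b) set" where
  "cinf_hom A B = {\<phi> \<in> carrier A \<rightarrow>\<^sub>E carrier B.
     \<forall>n. \<forall>f \<in> Cinf n. \<forall>a \<in> {..<n} \<rightarrow> carrier A. \<phi> (oper A n f a) = oper B n f (\<lambda>i. \<phi> (a i))}"

definition real_cinf :: "real cinf_ring" where
  "real_cinf = \<lparr>carrier = UNIV, oper = (\<lambda>n f a. f a)\<rparr>"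

text \<open>
  The underlying \<open>\<real>\<close>-algebra. A nullary operation ignores its tuple argument, for which
  \<open>\<lambda>i. undefined\<close> is supplied.
\<close>

definition alg :: "'a cinf_ring \<Rightarrow> (real, 'a) module" where
  "alg A = \<lparr>carrier = carrier A,
     mult = (\<lambda>a b. oper A 2 (\<lambda>v. v 0 * v 1) (\<lambda>i. if i = 0 then a else b)),
     one = oper A 0 (\<lambda>v. 1) (\<lambda>i. undefined),
     zero = oper A 0 (\<lambda>v. 0) (\<lambda>i. undefined),
     add = (\<lambda>a b. oper A 2 (\<lambda>v. v 0 + v 1) (\<lambda>i. if i = 0 then a else b)),
     smult = (\<lambda>c a. oper A 1 (\<lambda>v. c * v 0) (\<lambda>i. a))\<rparr>"


section \<open>Poisson \<open>C\<^sup>\<infinity>\<close>-rings\<close>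

locale poisson_cinf_ring = cinf_ring A
  for A :: "'a cinf_ring" +
  fixes br :: "'a \<Rightarrow> 'a \<Rightarrow> 'a"
  assumes br_closed:
      "\<lbrakk>a \<in> carrier A; b \<in> carrier A\<rbrakk> \<Longrightarrow> br a b \<in> carrier A"
    and br_add_left:
      "\<lbrakk>a \<in> carrier A; b \<in> carrier A; c \<in> carrier A\<rbrakk>
        \<Longrightarrow> br (a \<oplus>\<^bsub>alg A\<^esub> b) c = br a c \<oplus>\<^bsub>alg A\<^esub> br b c"
    and br_add_right:
      "\<lbrakk>a \<in> carrier A; b \<in> carrier A; c \<in> carrier A\<rbrakk>
        \<Longrightarrow> br a (b \<oplus>\<^bsub>alg A\<^esub> c) = br a b \<oplus>\<^bsub>alg A\<^esub> br a c"
    and br_smult_left: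
      "\<lbrakk>a \<in> carrier A; b \<in> carrier A\<rbrakk> \<Longrightarrow> br (r \<odot>\<^bsub>alg A\<^esub> a) b = r \<odot>\<^bsub>alg A\<^esub> br a b"
    and br_smult_right:
      "\<lbrakk>a \<in> carrier A; b \<in> carrier A\<rbrakk> \<Longrightarrow> br a (r \<odot>\<^bsub>alg A\<^esub> b) = r \<odot>\<^bsub>alg A\<^esub> br a b"
    and br_self:
      "a \<in> carrier A \<Longrightarrow> br a a = \<zero>\<^bsub>alg A\<^esub>"
    and br_jacobi:
      "\<lbrakk>a \<in> carrier A; b \<in> carrier A; c \<in> carrier A\<rbrakk>
        \<Longrightarrow> br a (br b c) \<oplus>\<^bsub>alg A\<^esub> br b (br c a) \<oplus>\<^bsub>alg A\<^esub> br c (br a b) = \<zero>\<^bsub>alg A\<^esub>"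
    and br_leibniz_left:
      "\<lbrakk>a \<in> carrier A; b \<in> carrier A; c \<in> carrier A\<rbrakk>
        \<Longrightarrow> br (a \<otimes>\<^bsub>alg A\<^esub> b) c = a \<otimes>\<^bsub>alg A\<^esub> br b c \<oplus>\<^bsub>alg A\<^esub> br a c \<otimes>\<^bsub>alg A\<^esub> b"
    and br_leibniz_right:
      "\<lbrakk>a \<in> carrier A; b \<in> carrier A; c \<in> carrier A\<rbrakk>
        \<Longrightarrow> br a (b \<otimes>\<^bsub>alg A\<^esub> c) = b \<otimes>\<^bsub>alg A\<^esub> br a c \<oplus>\<^bsub>alg A\<^esub> br a b \<otimes>\<^bsub>alg A\<^esub> c"
    and br_cinf_derivation:
      "\<lbrakk>n > 0; f \<in> Cinf n; a \<in> carrier A; d \<in> {..<n} \<rightarrow> carrier A\<rbrakk>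
        \<Longrightarrow> br a (oper A n f d) =
            (\<Oplus>\<^bsub>alg A\<^esub>i\<in>{..<n}. oper A n (partial i f) d \<otimes>\<^bsub>alg A\<^esub> br a (d i))"

definition poisson_hom ::
    "'a cinf_ring \<Rightarrow> ('a \<Rightarrow> 'a \<Rightarrow> 'a) \<Rightarrow> 'b cinf_ring \<Rightarrow> ('b \<Rightarrow> 'b \<Rightarrow> 'b) \<Rightarrow> ('a \<Rightarrow> 'b) set" where
  "poisson_hom A br B br' = {\<phi> \<in> cinf_hom A B.
     \<forall>a\<in>carrier A. \<forall>b\<in>carrier A. \<phi> (br a b) = br' (\<phi> a) (\<phi> b)}"


section \<open>Sheaves\<close>

text \<open>
  A presheaf on \<open>X\<close> consists of \<open>F U\<close> for open \<open>U\<close> and restriction maps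
  \<open>res U V : F U \<rightarrow> F V\<close> for open \<open>V \<subseteq> U\<close>.
\<close>

locale cinf_sheaf =
  fixes X :: "'x topology"
    and F :: "'x set \<Rightarrow> 's cinf_ring"
    and res :: "'x set \<Rightarrow> 'x set \<Rightarrow> 's \<Rightarrow> 's"
  assumes sections_cinf: "openin X U \<Longrightarrow> cinf_ring (F U)"
    and res_hom:
      "\<lbrakk>openin X U; openin X V; V \<subseteq> U\<rbrakk> \<Longrightarrow> res U V \<in> cinf_hom (F U) (F V)"
    and res_id:
      "\<lbrakk>openin X U; s \<in> carrier (F U)\<rbrakk> \<Longrightarrow> res U U s = s"
    and res_comp:
      "\<lbrakk>openin X U; openin X V; openin X W; W \<subseteq> V; V \<subseteq> U; s \<in> carrier (F U)\<rbrakk>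
        \<Longrightarrow> res V W (res U V s) = res U W s"
    and glue:
      "\<lbrakk>\<And>V. V \<in> \<V> \<Longrightarrow> openin X V;
        \<And>V. V \<in> \<V> \<Longrightarrow> \<sigma> V \<in> carrier (F V);
        \<And>V W. \<lbrakk>V \<in> \<V>; W \<in> \<V>\<rbrakk> \<Longrightarrow> res V (V \<inter> W) (\<sigma> V) = res W (V \<inter> W) (\<sigma> W)\<rbrakk>
        \<Longrightarrow> \<exists>!s. s \<in> carrier (F (\<Union>\<V>)) \<and> (\<forall>V\<in>\<V>. res (\<Union>\<V>) V s = \<sigma> V)"

locale poisson_cinf_sheaf = cinf_sheaf X F res
  for X :: "'x topology" and F :: "'x set \<Rightarrow> 's cinf_ring"
    and res :: "'x set \<Rightarrow> 'x set \<Rightarrow> 's \<Rightarrow> 's" +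
  fixes Br :: "'x set \<Rightarrow> 's \<Rightarrow> 's \<Rightarrow> 's"
  assumes sections_poisson: "openin X U \<Longrightarrow> poisson_cinf_ring (F U) (Br U)"
    and res_poisson:
      "\<lbrakk>openin X U; openin X V; V \<subseteq> U\<rbrakk> \<Longrightarrow> res U V \<in> poisson_hom (F U) (Br U) (F V) (Br V)"

text \<open>The stalk at a point, as the \<open>C\<^sup>\<infinity>\<close>-ring of germs of sections.\<close>

definition germ_rel ::
    "'x topology \<Rightarrow> ('x set \<Rightarrow> 's cinf_ring) \<Rightarrow> ('x set \<Rightarrow> 'x set \<Rightarrow> 's \<Rightarrow> 's) \<Rightarrow> 'x
      \<Rightarrow> (('x set \<times> 's) \<times> ('x set \<times> 's)) set" where
  "germ_rel X F res x = {((U, s), (V, t)).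
     openin X U \<and> x \<in> U \<and> s \<in> carrier (F U) \<and>
     openin X V \<and> x \<in> V \<and> t \<in> carrier (F V) \<and>
     (\<exists>W. openin X W \<and> x \<in> W \<and> W \<subseteq> U \<inter> V \<and> res U W s = res V W t)}"

text \<open>
  An operation is applied to germs by choosing representatives and restricting them to the
  intersection of their domains; for a sheaf the outcome does not depend on the choice.
\<close>

definition stalk ::
    "'x topology \<Rightarrow> ('x set \<Rightarrow> 's cinf_ring) \<Rightarrow> ('x set \<Rightarrow> 'x set \<Rightarrow> 's \<Rightarrow> 's) \<Rightarrow> 'x
      \<Rightarrow> ('x set \<times> 's) set cinf_ring" where
  "stalk X F res x = \<lparr>
     carrier = {(U, s). openin X U \<and> x \<in> U \<and> s \<in> carrier (F U)} // germ_rel X F res x,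
     oper = (\<lambda>n f g.
       let r = (\<lambda>i. SOME p. p \<in> g i);
           W = topspace X \<inter> (\<Inter>i\<in>{..<n}. fst (r i))
       in germ_rel X F res x `` {(W, oper (F W) n f (\<lambda>i. res (fst (r i)) W (snd (r i))))})\<rparr>"

definition local_cinf_ring :: "'a cinf_ring \<Rightarrow> bool" where
  "local_cinf_ring A \<longleftrightarrow> cinf_ring A \<and> (\<exists>!p. p \<in> cinf_hom A real_cinf)"

locale local_cinf_ringed_space = cinf_sheaf +
  assumes stalk_local: "x \<in> topspace X \<Longrightarrow> local_cinf_ring (stalk X F res x)"


section \<open>Localization\<close>

text \<open>
  The universal property of \<open>\<pi> : A \<rightarrow> L\<close> among the \<open>C\<^sup>\<infinity>\<close>-rings carried by subsets of the type \<open>'c\<close>.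
\<close>

definition is_localization ::
    "'c itself \<Rightarrow> 'a cinf_ring \<Rightarrow> 'a set \<Rightarrow> 'b cinf_ring \<Rightarrow> ('a \<Rightarrow> 'b) \<Rightarrow> bool" where
  "is_localization _ A S L \<pi> \<longleftrightarrow>
     cinf_ring L \<and> \<pi> \<in> cinf_hom A L \<and> \<pi> ` S \<subseteq> Units (alg L) \<and>
     (\<forall>B :: 'c cinf_ring. cinf_ring B \<longrightarrow>
        (\<forall>\<phi> \<in> cinf_hom A B. \<phi> ` S \<subseteq> Units (alg B) \<longrightarrow>
           (\<exists>!\<psi>. \<psi> \<in> cinf_hom L B \<and> (\<forall>a\<in>carrier A. \<psi> (\<pi> a) = \<phi> a))))"

text \<open>
  \<open>'a set\<close> is large enough both for the localization and for testing its universal property: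
  the subring of \<open>B\<close> generated by \<open>\<phi>(A)\<close> and the inverses of \<open>\<phi>(S)\<close> is either trivial or, \<open>A\<close> then
  containing \<open>\<real>\<close> and there being only continuum many operations, of cardinality at most that
  of \<open>A\<close>. The localization is determined up to unique isomorphism; one is chosen.
\<close>

definition localization :: "'a cinf_ring \<Rightarrow> 'a set \<Rightarrow> 'a set cinf_ring \<times> ('a \<Rightarrow> 'a set)" where
  "localization A S = (SOME (L, \<pi>). is_localization TYPE('a set) A S L \<pi>)"


section \<open>The spectrum of a \<open>C\<^sup>\<infinity>\<close>-ring\<close>

definition points :: "'a cinf_ring \<Rightarrow> ('a \<Rightarrow> real) set" where
  "points A = cinf_hom A real_cinf"

definition basic_open :: "'a cinf_ring \<Rightarrow> 'a \<Rightarrow> ('a \<Rightarrow> real) set" where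
  "basic_open A a = {x \<in> points A. x a \<noteq> 0}"

definition Spec_top :: "'a cinf_ring \<Rightarrow> ('a \<Rightarrow> real) topology" where
  "Spec_top A = topology (arbitrary union_of (\<lambda>U. \<exists>a\<in>carrier A. U = basic_open A a))"

definition loc_at :: "'a cinf_ring \<Rightarrow> ('a \<Rightarrow> real) \<Rightarrow> 'a set cinf_ring" where
  "loc_at A x = fst (localization A {a \<in> carrier A. x a \<noteq> 0})"

definition loc_map :: "'a cinf_ring \<Rightarrow> ('a \<Rightarrow> real) \<Rightarrow> 'a \<Rightarrow> 'a set" where
  "loc_map A x = snd (localization A {a \<in> carrier A. x a \<noteq> 0})"

text \<open>
  A map from \<open>U\<close> to the disjoint union of the \<open>A\<^sub>x\<close> with the value at \<open>x\<close> in \<open>A\<^sub>x\<close> is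
  an element of the dependent product.
\<close>

definition Spec_sheaf :: "'a cinf_ring \<Rightarrow> ('a \<Rightarrow> real) set \<Rightarrow> (('a \<Rightarrow> real) \<Rightarrow> 'a set) cinf_ring" where
  "Spec_sheaf A U = \<lparr>
     carrier = {s \<in> (\<Pi>\<^sub>E x\<in>U. carrier (loc_at A x)).
       \<exists>\<V>. (\<forall>V\<in>\<V>. openin (Spec_top A) V) \<and> \<Union>\<V> = U \<and>
         (\<forall>V\<in>\<V>. \<exists>a\<in>carrier A. \<forall>x\<in>V. s x = loc_map A x a)},
     oper = (\<lambda>n f s. \<lambda>x\<in>U. oper (loc_at A x) n f (\<lambda>i. s i x))\<rparr>"

definition Spec_res ::
    "'a cinf_ring \<Rightarrow> ('a \<Rightarrow> real) set \<Rightarrow> ('a \<Rightarrow> real) set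
      \<Rightarrow> (('a \<Rightarrow> real) \<Rightarrow> 'a set) \<Rightarrow> (('a \<Rightarrow> real) \<Rightarrow> 'a set)" where
  "Spec_res A U V = (\<lambda>s\<in>carrier (Spec_sheaf A U). restrict s V)"

definition Spec_section :: "'a cinf_ring \<Rightarrow> 'a \<Rightarrow> ('a \<Rightarrow> real) \<Rightarrow> 'a set" where
  "Spec_section A a = (\<lambda>x\<in>points A. loc_map A x a)"

text \<open>
  That a sheaf of \<open>C\<^sup>\<infinity>\<close>-rings is a sheaf of Poisson \<open>C\<^sup>\<infinity>\<close>-rings means that its sections carry
  Poisson brackets. Every sheaf has the zero bracket, so for \<open>Spec\<close> of a Poisson \<open>C\<^sup>\<infinity>\<close>-ring the
  brackets \<open>Br\<close> have to be the ones induced by the bracket of \<open>A\<close>. This is expressed by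
  requiring that \<open>a \<mapsto> \<s>\<^sub>a\<close> is a map of Poisson \<open>C\<^sup>\<infinity>\<close>-rings from \<open>A\<close> to the global sections;
  it determines \<open>Br\<close>, as sections are locally of the form \<open>\<s>\<^sub>a\<close> and restrictions preserve \<open>Br\<close>.
\<close>

definition induced_poisson_structure ::
    "'a cinf_ring \<Rightarrow> ('a \<Rightarrow> 'a \<Rightarrow> 'a)
      \<Rightarrow> (('a \<Rightarrow> real) set \<Rightarrow> (('a \<Rightarrow> real) \<Rightarrow> 'a set) \<Rightarrow> (('a \<Rightarrow> real) \<Rightarrow> 'a set)
           \<Rightarrow> (('a \<Rightarrow> real) \<Rightarrow> 'a set)) \<Rightarrow> bool" where
  "induced_poisson_structure A br Br \<longleftrightarrow>
     (\<lambda>a\<in>carrier A. Spec_section A a)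
       \<in> poisson_hom A br (Spec_sheaf A (points A)) (Br (points A))"

end

theory Submission
  imports Defs "HOL-Computational_Algebra.Polynomial"
begin

text \<open>
  Everything reduces to one fact: for an \<open>\<real>\<close>-point \<open>x\<close> of \<open>A\<close>, the localization \<open>A\<^sub>x\<close> is the quotient of
  \<open>A\<close> by the relation \<open>a \<sim> b\<close> saying that \<open>a d = b d\<close> for some \<open>d\<close> with \<open>x d \<noteq> 0\<close>.

  That this quotient is a \<open>C\<^sup>\<infinity>\<close>-ring rests on Hadamard's lemma: \<open>f(u) - f(v)\<close> is divisible by
  \<open>u - v\<close> in the ring of smooth functions, so \<open>a d = b d\<close> implies \<open>f(a) d = f(b) d\<close>
  (\<open>Hadamard_coordinate\<close>, \<open>oper_change_coordinate\<close>, \<open>rel_oper\<close>). That the elements with \<open>x a \<noteq> 0\<close>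
  become invertible in it rests on a flat function: there are smooth \<open>g\<close> and \<open>\<rho>\<close> with
  \<open>t g(t) \<rho>(t) = \<rho>(t)\<close> and \<open>\<rho>(2) \<noteq> 0\<close>, and applying them to a positive multiple of \<open>a\<^sup>2\<close> gives an
  inverse of \<open>a\<close> up to \<open>\<sim>\<close> (\<open>local_reciprocal\<close>, \<open>local_inverse\<close>). The universal property is then
  immediate, and it transfers the description to the localization that was chosen, because any two
  localizations are isomorphic under \<open>A\<close> (\<open>localization_kernel\<close>).

  Sections of the structure sheaf are functions that are locally given by elements of \<open>A\<close>, with
  pointwise operations, so the sheaf axioms hold almost by construction. If \<open>\<s>\<^sub>a\<close> and \<open>\<s>\<^sub>b\<close>
  agree at \<open>x\<close>, then \<open>a d = b d\<close> with \<open>x d \<noteq> 0\<close>, and they agree on the whole neighbourhood where \<open>d\<close> does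
  not vanish; hence evaluation identifies the stalk at \<open>x\<close> with \<open>A\<^sub>x\<close>. The latter has exactly one
  \<open>\<real>\<close>-point, since a point \<open>y\<close> of \<open>A\<close> with \<open>y a \<noteq> 0\<close> whenever \<open>x a \<noteq> 0\<close> must be \<open>x\<close>: apply this to
  \<open>a - y(a)\<close>.

  For the brackets, let \<open>a d = b d\<close>. The Leibniz rule for \<open>{c, a d} d = {c, b d} d\<close> leaves
  \<open>{c, a} d\<^sup>2 = {c, b} d\<^sup>2\<close>, as the other terms \<open>a d {c, d}\<close> and \<open>b d {c, d}\<close> coincide. So the bracket of
  \<open>A\<close> descends to every \<open>A\<^sub>x\<close> (\<open>bracket_germ\<close>). The Poisson axioms pass from \<open>A\<close> to its quotient \<open>A\<^sub>x\<close>
  (\<open>poisson_quotient\<close>) and from the \<open>A\<^sub>x\<close> to a ring of sections, which embeds into their product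
  (\<open>poisson_subproduct\<close>). The pointwise bracket of two sections is again a section, being locally
  \<open>\<s>\<^bsub>{a, b}\<^esub>\<close>.
\<close>

section \<open>Smooth functions\<close>

text \<open>
  A class of continuous functions of the first \<open>n\<close> coordinates that is closed under partial
  derivatives consists of smooth functions. This is how smoothness is proved below: one exhibits
  such a class instead of computing higher derivatives.
\<close>

lemma Cinf_coinduct:
  assumes "P f"
    and dep: "\<And>f x y. \<lbrakk>P f; \<And>i. i < n \<Longrightarrow> x i = y i\<rbrakk> \<Longrightarrow> f x = f y"
    and cont: "\<And>f. P f \<Longrightarrow> continuous_on UNIV f"
    and der: "\<And>f i. \<lbrakk>P f; i < n\<rbrakk> \<Longrightarrow>
      \<exists>g. P g \<and> (\<forall>x. ((\<lambda>t. f (x(i := t))) has_real_derivative g x) (at (x i)))"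
  shows "f \<in> Cinf n"
proof -
  have "Ck n k f" if "P f" for k f
    using that
  proof (induction k arbitrary: f)
    case 0
    then show ?case by (simp add: cont)
  next
    case (Suc k)
    have "(\<forall>x. (\<lambda>t. f (x(i := t))) differentiable (at (x i))) \<and> Ck n k (partial i f)"
      if i: "i < n" for i
    proof
      obtain g where g: "P g" "\<And>x. ((\<lambda>t. f (x(i := t))) has_real_derivative g x) (at (x i))"
        using der[OF Suc.prems i] by blast
      have "partial i f = g"
        using g(2) by (auto simp: partial_def intro!: DERIV_imp_deriv)
      with g(1) Suc.IH show "Ck n k (partial i f)" by simp
      show "\<forall>x. (\<lambda>t. f (x(i := t))) differentiable (at (x i))"
        using g(2) by (auto simp: real_differentiable_def)
    qed
    with Suc.prems show ?case by (simp add: cont)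
  qed
  with assms(1) show ?thesis
    unfolding Cinf_def by (intro CollectI conjI allI impI) (rule dep, auto)
qed

lemma Cinf_dep: "\<lbrakk>f \<in> Cinf n; \<And>i. i < n \<Longrightarrow> x i = y i\<rbrakk> \<Longrightarrow> f x = f y"
  by (auto simp: Cinf_def)

lemma Cinf_continuous: "f \<in> Cinf n \<Longrightarrow> continuous_on UNIV f"
  unfolding Cinf_def using Ck.simps(1) by blast

lemma Cinf_deriv:
  assumes "f \<in> Cinf n" "i < n"
  shows "((\<lambda>t. f (x(i := t))) has_real_derivative partial i f (x(i := s))) (at s)"
proof -
  have "Ck n (Suc 0) f" using assms(1) unfolding Cinf_def by blast
  then have "(\<lambda>t. f ((x(i := s))(i := t))) differentiable (at ((x(i := s)) i))"
    using assms(2) unfolding Ck.simps by blast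
  then show ?thesis
    by (simp add: partial_def DERIV_deriv_iff_real_differentiable)
qed

lemma Cinf_partial:
  assumes "f \<in> Cinf n" "i < n"
  shows "partial i f \<in> Cinf n"
proof -
  have "Ck n k (partial i f)" for k
  proof -
    have "Ck n (Suc k) f" using assms(1) unfolding Cinf_def by blast
    with assms(2) show ?thesis by simp
  qed
  moreover have "partial i f x = partial i f y" if "\<forall>j<n. x j = y j" for x y
  proof -
    have "f (x(i := t)) = f (y(i := t))" for t
      by (rule Cinf_dep[OF assms(1)]) (simp add: that)
    with that assms(2) show ?thesis by (simp add: partial_def)
  qed
  ultimately show ?thesis unfolding Cinf_def by simp
qed

lemma Cinf_mono:
  assumes "f \<in> Cinf m" "m \<le> n"
  shows "f \<in> Cinf n"
proof (rule Cinf_coinduct[where P = "\<lambda>f. f \<in> Cinf m"])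
  fix f i assume f: "f \<in> Cinf m" and i: "i < n"
  show "\<exists>g. g \<in> Cinf m \<and> (\<forall>x. ((\<lambda>t. f (x(i := t))) has_real_derivative g x) (at (x i)))"
  proof (cases "i < m")
    case True
    have "((\<lambda>t. f (x(i := t))) has_real_derivative partial i f x) (at (x i))" for x
      using Cinf_deriv[OF f True, of x "x i"] by simp
    then show ?thesis
      by (intro exI[of _ "partial i f"] conjI allI Cinf_partial[OF f True])
  next
    case False
    have const: "f (x(i := t)) = f x" for x t
      using False by (intro Cinf_dep[OF f]) auto
    have "(\<lambda>v. 0) \<in> Cinf m"
      by (rule Cinf_coinduct[where P = "\<lambda>f. f = (\<lambda>v. 0)"]) (auto intro!: exI[of _ "\<lambda>v. 0"])
    then show ?thesis
      by (intro exI[of _ "\<lambda>v. 0"]) (simp add: const)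
  qed
next
  fix f and x y :: "nat \<Rightarrow> real" assume f: "f \<in> Cinf m" and xy: "\<And>i. i < n \<Longrightarrow> x i = y i"
  show "f x = f y"
    by (rule Cinf_dep[OF f]) (rule xy, rule less_le_trans[OF _ assms(2)])
qed (rule assms(1), erule Cinf_continuous)

text \<open>
  The functions built from smooth ones by sums, products and reciprocals form a class that is closed
  under partial derivatives; thus \<open>Cinf n\<close> is closed under these operations.
\<close>

inductive_set smooth_expr :: "nat \<Rightarrow> ((nat \<Rightarrow> real) \<Rightarrow> real) set" for n where
  const: "(\<lambda>v. c) \<in> smooth_expr n"
| proj: "i < n \<Longrightarrow> (\<lambda>v. v i) \<in> smooth_expr n"
| base: "f \<in> Cinf n \<Longrightarrow> f \<in> smooth_expr n"
| plus: "\<lbrakk>f \<in> smooth_expr n; g \<in> smooth_expr n\<rbrakk> \<Longrightarrow> (\<lambda>v. f v + g v) \<in> smooth_expr n"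
| times: "\<lbrakk>f \<in> smooth_expr n; g \<in> smooth_expr n\<rbrakk> \<Longrightarrow> (\<lambda>v. f v * g v) \<in> smooth_expr n"
| recip: "\<lbrakk>f \<in> smooth_expr n; \<And>v. f v \<noteq> 0\<rbrakk> \<Longrightarrow> (\<lambda>v. 1 / f v) \<in> smooth_expr n"

lemma smooth_expr_deriv:
  assumes "f \<in> smooth_expr n" "i < n"
  shows "\<exists>g \<in> smooth_expr n. \<forall>x. ((\<lambda>t. f (x(i := t))) has_real_derivative g x) (at (x i))"
  using assms(1)
proof induction
  case (const c)
  show ?case by (rule bexI[OF _ smooth_expr.const[of 0]]) auto
next
  case (proj j)
  show ?case
    by (rule bexI[OF _ smooth_expr.const[of "if i = j then 1 else 0"]]) auto
next
  case (base f)
  have "((\<lambda>t. f (x(i := t))) has_real_derivative partial i f x) (at (x i))" for x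
    using Cinf_deriv[OF base assms(2), of x "x i"] by simp
  with smooth_expr.base[OF Cinf_partial[OF base assms(2)]] show ?case by blast
next
  case (plus f g)
  then obtain f' g' where *: "f' \<in> smooth_expr n" "g' \<in> smooth_expr n"
    "\<And>x. ((\<lambda>t. f (x(i := t))) has_real_derivative f' x) (at (x i))"
    "\<And>x. ((\<lambda>t. g (x(i := t))) has_real_derivative g' x) (at (x i))" by blast
  have "((\<lambda>t. f (x(i := t)) + g (x(i := t))) has_real_derivative f' x + g' x) (at (x i))" for x
    by (rule DERIV_add[OF *(3,4)])
  then show ?case by (intro bexI[OF _ smooth_expr.plus[OF *(1,2)]] allI)
next
  case (times f g)
  then obtain f' g' where *: "f' \<in> smooth_expr n" "g' \<in> smooth_expr n"
    "\<And>x. ((\<lambda>t. f (x(i := t))) has_real_derivative f' x) (at (x i))"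
    "\<And>x. ((\<lambda>t. g (x(i := t))) has_real_derivative g' x) (at (x i))" by blast
  have "((\<lambda>t. f (x(i := t)) * g (x(i := t))) has_real_derivative
      (f' x * g x + g' x * f x)) (at (x i))" for x
    using DERIV_mult[OF *(3)[of x] *(4)[of x]] by simp
  moreover have "(\<lambda>x. f' x * g x + g' x * f x) \<in> smooth_expr n"
    using times * by (intro smooth_expr.plus smooth_expr.times)
  ultimately show ?case by (intro bexI[of _ "\<lambda>x. f' x * g x + g' x * f x"] allI)
next
  case (recip f)
  then obtain f' where *: "f' \<in> smooth_expr n"
    "\<And>x. ((\<lambda>t. f (x(i := t))) has_real_derivative f' x) (at (x i))" by blast
  have "((\<lambda>t. 1 / f (x(i := t))) has_real_derivative
      (- 1 * (f' x * ((1 / f x) * (1 / f x))))) (at (x i))" for x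
    using recip.hyps(2)[of x] by (auto intro!: derivative_eq_intros *(2))
  moreover have "(\<lambda>x. - 1 * (f' x * ((1 / f x) * (1 / f x)))) \<in> smooth_expr n"
    using recip * by (intro smooth_expr.times smooth_expr.const smooth_expr.recip) auto
  ultimately show ?case by (intro bexI[of _ "\<lambda>x. - 1 * (f' x * ((1 / f x) * (1 / f x)))"] allI)
qed

lemma smooth_expr_Cinf:
  assumes "f \<in> smooth_expr n"
  shows "f \<in> Cinf n"
proof (rule Cinf_coinduct[where P = "\<lambda>f. f \<in> smooth_expr n"])
  fix f and x y :: "nat \<Rightarrow> real" assume "f \<in> smooth_expr n" and xy: "\<And>i. i < n \<Longrightarrow> x i = y i"
  from this(1) show "f x = f y"
  proof induction
    case (base f)
    then show ?case using Cinf_dep xy by blast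
  qed (simp_all add: xy)
next
  fix f assume "f \<in> smooth_expr n"
  then show "continuous_on UNIV f"
  proof induction
    case (base f)
    then show ?case by (rule Cinf_continuous)
  qed (auto intro!: continuous_on_add continuous_on_mult continuous_on_divide)
next
  fix f i assume "f \<in> smooth_expr n" "i < n"
  from smooth_expr_deriv[OF this]
  show "\<exists>g. g \<in> smooth_expr n \<and>
      (\<forall>x. ((\<lambda>t. f (x(i := t))) has_real_derivative g x) (at (x i)))"
    by (rule bexE) (rule exI, rule conjI)
qed (fact assms)

lemma Cinf_const [simp]: "(\<lambda>v. c) \<in> Cinf n"
  by (rule smooth_expr_Cinf[OF smooth_expr.const])

lemma Cinf_proj [simp]: "i < n \<Longrightarrow> (\<lambda>v. v i) \<in> Cinf n"
  by (rule smooth_expr_Cinf[OF smooth_expr.proj])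

lemma Cinf_add [simp]: "\<lbrakk>f \<in> Cinf n; g \<in> Cinf n\<rbrakk> \<Longrightarrow> (\<lambda>v. f v + g v) \<in> Cinf n"
  by (rule smooth_expr_Cinf[OF smooth_expr.plus[OF smooth_expr.base smooth_expr.base]])

lemma Cinf_mult [simp]: "\<lbrakk>f \<in> Cinf n; g \<in> Cinf n\<rbrakk> \<Longrightarrow> (\<lambda>v. f v * g v) \<in> Cinf n"
  by (rule smooth_expr_Cinf[OF smooth_expr.times[OF smooth_expr.base smooth_expr.base]])

lemma Cinf_uminus [simp]: "f \<in> Cinf n \<Longrightarrow> (\<lambda>v. - f v) \<in> Cinf n"
  using Cinf_mult[OF Cinf_const[of "- 1"]] by simp

lemma Cinf_diff [simp]: "\<lbrakk>f \<in> Cinf n; g \<in> Cinf n\<rbrakk> \<Longrightarrow> (\<lambda>v. f v - g v) \<in> Cinf n"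
  using Cinf_add[OF _ Cinf_uminus, of f n g] by simp

lemma Cinf_recip: "\<lbrakk>f \<in> Cinf n; \<And>v. f v \<noteq> 0\<rbrakk> \<Longrightarrow> (\<lambda>v. 1 / f v) \<in> Cinf n"
  by (rule smooth_expr_Cinf[OF smooth_expr.recip[OF smooth_expr.base]])

section \<open>Hadamard's lemma in one coordinate\<close>

text \<open>
  A weighted mean of \<open>f\<close> over the segment along which coordinate \<open>i\<close> moves from \<open>v\<^sub>n\<close> to \<open>v\<^sub>i\<close>. The
  coordinate \<open>n\<close> is one on which \<open>f\<close> does not depend; it stores the other end point. The weight \<open>p\<close>
  is there to make the class of these means closed under differentiation.
\<close>

definition line_mean ::
    "nat \<Rightarrow> nat \<Rightarrow> (real \<Rightarrow> real) \<Rightarrow> ((nat \<Rightarrow> real) \<Rightarrow> real) \<Rightarrow> (nat \<Rightarrow> real) \<Rightarrow> real" where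
  "line_mean i n p f v = integral {0..1} (\<lambda>t. p t * f (v(i := v n + t * (v i - v n))))"

lemma continuous_on_line:
  fixes u :: "'b::topological_space \<Rightarrow> nat \<Rightarrow> real" and w :: "'b \<Rightarrow> real"
  assumes "continuous_on S u" "continuous_on S w"
  shows "continuous_on S (\<lambda>z. (u z)(i := u z n + w z * (u z i - u z n)))"
proof (rule continuous_on_coordinatewise_then_product)
  note [continuous_intros] = continuous_on_product_then_coordinatewise[OF assms(1)] assms(2)
  show "continuous_on S (\<lambda>z. ((u z)(i := u z n + w z * (u z i - u z n))) j)" for j
    by (cases "j = i") (auto intro!: continuous_intros)
qed

lemma continuous_on_line_integrand:
  fixes u :: "'b::topological_space \<Rightarrow> nat \<Rightarrow> real" and w :: "'b \<Rightarrow> real"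
  assumes "continuous_on UNIV p" "f \<in> Cinf n" "continuous_on S u" "continuous_on S w"
  shows "continuous_on S (\<lambda>z. p (w z) * f ((u z)(i := u z n + w z * (u z i - u z n))))"
  by (intro continuous_on_mult continuous_on_compose2[OF assms(1)]
      continuous_on_compose2[OF Cinf_continuous[OF assms(2)]] continuous_on_line assms)
     auto

text \<open>
  Differentiation under the integral sign. By the chain rule, the derivative in coordinate \<open>i\<close>
  brings in a factor \<open>t\<close>, that in coordinate \<open>n\<close> a factor \<open>1 - t\<close>, and both are absorbed into the weight.
\<close>

lemma line_mean_deriv:
  assumes p: "continuous_on UNIV p" and f: "f \<in> Cinf n" and i: "i < n" and j: "j < Suc n"
  shows "\<exists>q g. continuous_on UNIV q \<and> g \<in> Cinf n \<and>
    (\<forall>v. ((\<lambda>s. line_mean i n p f (v(j := s))) has_real_derivative line_mean i n q g v) (at (v j)))"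
proof -
  define k where "k = (if j = n then i else j)"
  define q where "q t = p t * (if j = i then t else if j = n then 1 - t else 1)" for t
  define g where "g = partial k f"
  have k: "k < n" using i j by (auto simp: k_def)
  have q: "continuous_on UNIV q"
    unfolding q_def using p by (cases "j = i"; cases "j = n") (auto intro!: continuous_intros)
  have g: "g \<in> Cinf n" unfolding g_def by (rule Cinf_partial[OF f k])
  have gk: "g = partial (if j = n then i else j) f" by (simp add: g_def k_def)
  let ?l = "\<lambda>v t. v(i := v n + t * (v i - v n))"
  have D: "((\<lambda>s. p t * f (?l (v(j := s)) t)) has_real_derivative
      q t * g (?l (v(j := s)) t)) (at s)" for v s t
  proof -
    consider "j = i" | "j = n" | "j \<noteq> i" "j < n" using j by linarith
    then show ?thesis
    proof cases
      case 1
      then have eq: "?l (v(j := r)) t = v(i := v n + t * (r - v n))" for r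
        using i by auto
      have "((\<lambda>r. f (v(i := v n + t * (r - v n)))) has_real_derivative
          g (v(i := v n + t * (s - v n))) * t) (at s)"
        unfolding gk using 1 i
        by (simp add: k_def, intro DERIV_chain2[OF Cinf_deriv[OF f]]) (auto intro!: derivative_eq_intros)
      from DERIV_cmult[OF this, of "p t"] show ?thesis
        unfolding eq q_def using 1 by (simp add: ac_simps)
    next
      case 2
      have eq: "h (?l (v(j := r)) t) = h (v(i := r + t * (v i - r)))" if "h \<in> Cinf n" for r h
        using i 2 by (intro Cinf_dep[OF that]) auto
      have "((\<lambda>r. f (v(i := r + t * (v i - r)))) has_real_derivative
          g (v(i := s + t * (v i - s))) * (1 - t)) (at s)"
        unfolding gk using 2 i
        by (simp add: k_def, intro DERIV_chain2[OF Cinf_deriv[OF f]]) (auto intro!: derivative_eq_intros)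
      from DERIV_cmult[OF this, of "p t"] show ?thesis
        unfolding eq[OF f] eq[OF g] q_def using 2 i by (simp add: ac_simps)
    next
      case 3
      then have eq: "?l (v(j := r)) t = (?l v t)(j := r)" for r
        by (auto simp: fun_upd_def)
      show ?thesis
        using DERIV_cmult[OF Cinf_deriv[OF f k, of "?l v t" s], of "p t"] 3
        unfolding eq g_def k_def q_def by simp
    qed
  qed
  have "((\<lambda>s. line_mean i n p f (v(j := s))) has_real_derivative line_mean i n q g v) (at (v j))" for v
  proof -
    have "((\<lambda>s. integral (cbox 0 1) (\<lambda>t. p t * f (?l (v(j := s)) t))) has_real_derivative
        integral (cbox 0 1) (\<lambda>t. q t * g (?l (v(j := v j)) t))) (at (v j) within UNIV)"
    proof (rule leibniz_rule_field_derivative)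
      show "((\<lambda>s. p t * f (?l (v(j := s)) t)) has_real_derivative
          q t * g (?l (v(j := s)) t)) (at s within UNIV)" for s t
        by (rule D)
      show "(\<lambda>t. p t * f (?l (v(j := s)) t)) integrable_on cbox 0 1" for s
        by (intro integrable_continuous continuous_on_line_integrand[OF p f])
           (auto intro: continuous_intros)
      have "continuous_on (UNIV \<times> cbox 0 1) (\<lambda>z. v(j := fst z))"
      proof (rule continuous_on_coordinatewise_then_product)
        show "continuous_on (UNIV \<times> cbox 0 1) (\<lambda>z. (v(j := fst z)) m)" for m
          by (cases "m = j") (auto intro!: continuous_intros)
      qed
      then show "continuous_on (UNIV \<times> cbox 0 1) (\<lambda>(s, t). q t * g (?l (v(j := s)) t))"
        unfolding case_prod_beta
        by (rule continuous_on_line_integrand[OF q g]) (intro continuous_intros)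
    qed auto
    then show ?thesis by (simp add: line_mean_def)
  qed
  with q g show ?thesis by blast
qed

lemma line_mean_Cinf:
  assumes "continuous_on UNIV p" "f \<in> Cinf n" "i < n"
  shows "line_mean i n p f \<in> Cinf (Suc n)"
proof (rule Cinf_coinduct[where P = "\<lambda>h. \<exists>p f. h = line_mean i n p f \<and>
      continuous_on UNIV p \<and> f \<in> Cinf n"])
  fix h and x y :: "nat \<Rightarrow> real"
  assume "\<exists>p f. h = line_mean i n p f \<and> continuous_on UNIV p \<and> f \<in> Cinf n"
    and xy: "\<And>j. j < Suc n \<Longrightarrow> x j = y j"
  then obtain p f where h: "h = line_mean i n p f" "f \<in> Cinf n" by blast
  have "f (x(i := x n + t * (x i - x n))) = f (y(i := y n + t * (y i - y n)))" for t
    using xy assms(3) by (intro Cinf_dep[OF h(2)]) auto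
  then show "h x = h y" by (simp add: h line_mean_def)
next
  fix h
  assume "\<exists>p f. h = line_mean i n p f \<and> continuous_on UNIV p \<and> f \<in> Cinf n"
  then obtain p f where h: "h = line_mean i n p f" "continuous_on UNIV p" "f \<in> Cinf n" by blast
  have "continuous_on UNIV
      (\<lambda>v. integral (cbox 0 1) (\<lambda>t. p t * f (v(i := v n + t * (v i - v n)))))"
    unfolding case_prod_beta
    by (intro integral_continuous_on_param, unfold case_prod_beta)
       (intro continuous_on_line_integrand[OF h(2,3)] continuous_intros)
  then show "continuous_on UNIV h"
    by (simp add: h line_mean_def[abs_def])
next
  fix h j
  assume "\<exists>p f. h = line_mean i n p f \<and> continuous_on UNIV p \<and> f \<in> Cinf n" "j < Suc n"
  then show "\<exists>g. (\<exists>p f. g = line_mean i n p f \<and> continuous_on UNIV p \<and> f \<in> Cinf n) \<and>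
      (\<forall>x. ((\<lambda>t. h (x(j := t))) has_real_derivative g x) (at (x j)))"
    using line_mean_deriv[OF _ _ assms(3)] by blast
qed (use assms in blast)

text \<open>
  The quotient \<open>g\<close> is the mean of \<open>\<partial>\<^sub>i f\<close> over the segment, by the fundamental theorem of calculus.
\<close>

lemma Hadamard_coordinate:
  assumes f: "f \<in> Cinf n" and i: "i < n"
  obtains g where "g \<in> Cinf (Suc n)" "\<And>v. f v = f (v(i := v n)) + (v i - v n) * g v"
proof -
  have A: "line_mean i n (\<lambda>t. 1) (partial i f) \<in> Cinf (Suc n)"
    by (rule line_mean_Cinf[OF _ Cinf_partial[OF f i] i]) simp
  have B: "f v = f (v(i := v n)) + (v i - v n) * line_mean i n (\<lambda>t. 1) (partial i f) v" for v
  proof -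
  define \<gamma> where "\<gamma> t = v n + t * (v i - v n)" for t
  have \<gamma>: "(\<gamma> has_real_derivative (v i - v n)) (at t)" for t
    unfolding \<gamma>_def by (auto intro!: derivative_eq_intros)
  have "((\<lambda>t. (v i - v n) * partial i f (v(i := \<gamma> t))) has_integral
      f (v(i := \<gamma> 1)) - f (v(i := \<gamma> 0))) {0..1}"
  proof (rule fundamental_theorem_of_calculus)
    fix t
    have "((\<lambda>t. f (v(i := \<gamma> t))) has_real_derivative
        partial i f (v(i := \<gamma> t)) * (v i - v n)) (at t)"
      by (rule DERIV_chain2[OF Cinf_deriv[OF f i, of v "\<gamma> t"] \<gamma>])
    then have "((\<lambda>t. f (v(i := \<gamma> t))) has_vector_derivative
        (v i - v n) * partial i f (v(i := \<gamma> t))) (at t)"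
      by (simp add: has_real_derivative_iff_has_vector_derivative mult.commute)
    then show "((\<lambda>t. f (v(i := \<gamma> t))) has_vector_derivative
        (v i - v n) * partial i f (v(i := \<gamma> t))) (at t within {0..1})"
      by (rule has_vector_derivative_at_within)
  qed simp
  from integral_unique[OF this]
  have "(v i - v n) * line_mean i n (\<lambda>t. 1) (partial i f) v = f (v(i := \<gamma> 1)) - f (v(i := \<gamma> 0))"
    by (simp add: line_mean_def \<gamma>_def)
  moreover have "v(i := \<gamma> 1) = v" "v(i := \<gamma> 0) = v(i := v n)"
    by (simp_all add: \<gamma>_def)
  ultimately show ?thesis by simp
  qed
  show thesis by (rule that[OF A B])
qed

section \<open>A smooth local reciprocal\<close>

text \<open>
  The polynomial factor makes the family closed under differentiation.
\<close>

definition flat :: "real poly \<Rightarrow> real \<Rightarrow> real" where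
  "flat p t = (if t > 0 then poly p (1 / t) * exp (- (1 / t)) else 0)"

lemma poly_exp_tendsto_0: "((\<lambda>s. poly p s * exp (- s)) \<longlongrightarrow> (0::real)) at_top"
proof -
  have "((\<lambda>s. \<Sum>i\<le>degree p. coeff p i * (s ^ i / exp s)) \<longlongrightarrow> (\<Sum>i\<le>degree p. coeff p i * 0)) at_top"
    by (intro tendsto_intros tendsto_power_div_exp_0)
  then show ?thesis
    by (simp add: poly_altdef exp_minus divide_inverse sum_distrib_right mult.assoc)
qed

text \<open>
  With \<open>s = 1/t\<close> the derivative of \<open>p(s) e\<^sup>-\<^sup>s\<close> is \<open>s\<^sup>2 (p(s) - p'(s)) e\<^sup>-\<^sup>s\<close>. At \<open>0\<close> the difference
  quotient is \<open>s p(s) e\<^sup>-\<^sup>s\<close>, which tends to \<open>0\<close> as \<open>s\<close> tends to infinity.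
\<close>

lemma flat_deriv: "(flat p has_real_derivative flat (monom 1 2 * (p - pderiv p)) t) (at t)"
proof -
  consider "t > 0" | "t < 0" | "t = 0" by linarith
  then show ?thesis
  proof cases
    case 1
    have "((\<lambda>t. poly p (1 / t) * exp (- (1 / t))) has_real_derivative
        flat (monom 1 2 * (p - pderiv p)) t) (at t)"
      using 1 by (auto intro!: derivative_eq_intros DERIV_chain2[OF poly_DERIV]
          simp: flat_def poly_monom field_simps power2_eq_square)
    then show ?thesis
      by (rule has_field_derivative_transform_within_open[of _ _ _ "{0<..}"])
         (use 1 in \<open>auto simp: flat_def\<close>)
  next
    case 2
    have "((\<lambda>t. 0) has_real_derivative flat (monom 1 2 * (p - pderiv p)) t) (at t)"
      using 2 by (simp add: flat_def)
    then show ?thesis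
      by (rule has_field_derivative_transform_within_open[of _ _ _ "{..<0}"])
         (use 2 in \<open>auto simp: flat_def\<close>)
  next
    case 3
    have "((\<lambda>h. poly (pCons 0 p) (1 / h) * exp (- (1 / h))) \<longlongrightarrow> 0) (at_right 0)"
      by (rule filterlim_compose[OF poly_exp_tendsto_0])
         (simp add: filterlim_inverse_at_top_right flip: inverse_eq_divide)
    then have "((\<lambda>h. flat p h / h) \<longlongrightarrow> 0) (at_right 0)"
      by (rule Lim_transform_eventually)
         (auto simp: flat_def eventually_at_filter)
    moreover have "((\<lambda>h. flat p h / h) \<longlongrightarrow> 0) (at_left 0)"
      by (rule Lim_transform_eventually[OF tendsto_const])
         (auto simp: flat_def eventually_at_filter)
    ultimately have "((\<lambda>h. flat p h / h) \<longlongrightarrow> 0) (at 0)"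
      by (simp add: filterlim_split_at)
    with 3 show ?thesis by (simp add: DERIV_def flat_def)
  qed
qed

lemma flat_affine_Cinf: "(\<lambda>v. flat p (\<alpha> * v 0 + \<beta>)) \<in> Cinf 1"
proof -
  define F where "F c p = (\<lambda>v. c * flat p (\<alpha> * v (0::nat) + \<beta>))" for c p
  have "F 1 p \<in> Cinf 1"
  proof (rule Cinf_coinduct[where P = "\<lambda>h. \<exists>c p. h = F c p"])
    show "\<exists>c q. F 1 p = F c q" by (intro exI) (rule refl)
  next
    fix h and x y :: "nat \<Rightarrow> real"
    assume "\<exists>c p. h = F c p" and xy: "\<And>i. i < 1 \<Longrightarrow> x i = y i"
    then obtain c q where h: "h = F c q" by (elim exE)
    have "x 0 = y 0" by (rule xy) simp
    then show "h x = h y" by (simp add: h F_def)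
  next
    fix h assume "\<exists>c p. h = F c p"
    then obtain c q where h: "h = F c q" by (elim exE)
    have "continuous_on UNIV (flat q)"
      by (intro continuous_at_imp_continuous_on ballI DERIV_isCont[OF flat_deriv])
    then have "continuous_on UNIV (\<lambda>v::nat \<Rightarrow> real. flat q (\<alpha> * v 0 + \<beta>))"
      by (rule continuous_on_compose2) (auto intro!: continuous_intros)
    then show "continuous_on UNIV h"
      unfolding h F_def by (intro continuous_on_mult continuous_on_const)
  next
    fix h and i :: nat assume "\<exists>c p. h = F c p" and i: "i < 1"
    then obtain c q where h: "h = F c q" by (elim exE)
    define q' where "q' = monom 1 2 * (q - pderiv q)"
    have "((\<lambda>t. h (x(i := t))) has_real_derivative F (c * \<alpha>) q' x) (at (x i))" for x
    proof -
      have "((\<lambda>t. \<alpha> * t + \<beta>) has_real_derivative \<alpha>) (at (x 0))"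
        by (auto intro!: derivative_eq_intros)
      from DERIV_cmult[OF DERIV_chain2[OF flat_deriv this], of c q]
      show ?thesis using i by (simp add: h F_def q'_def ac_simps)
    qed
    then show "\<exists>g. (\<exists>c p. g = F c p) \<and>
        (\<forall>x. ((\<lambda>t. h (x(i := t))) has_real_derivative g x) (at (x i)))"
      by (intro exI[of _ "F (c * \<alpha>) q'"] conjI allI) (intro exI, rule refl)
  qed
  then show ?thesis by (simp add: F_def)
qed

text \<open>
  A smooth \<open>g\<close> that agrees with \<open>1/t\<close> for \<open>t \<ge> 1\<close>, and a smooth \<open>\<rho>\<close> supported there and nonzero at
  \<open>2\<close>. The value \<open>2\<close> is an arbitrary choice above \<open>1\<close>, to which any nonzero value of a point can be
  brought by squaring and rescaling.
\<close>

lemma local_reciprocal: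
  obtains g \<rho> where "g \<in> Cinf 1" "\<rho> \<in> Cinf 1"
    "\<And>v. v 0 * g v * \<rho> v = \<rho> v" "\<And>v. v 0 = 2 \<Longrightarrow> \<rho> v \<noteq> 0"
proof
  \<comment> \<open>\<open>\<theta>\<close> is positive everywhere and equals \<open>t\<^sup>2\<close> for \<open>t \<ge> 1\<close>, so \<open>t / \<theta>\<close> is the required \<open>g\<close>.\<close>
  define \<theta> where "\<theta> v = v 0 * v 0 + flat 1 (- 1 * v 0 + 1)" for v :: "nat \<Rightarrow> real"
  have \<theta>: "\<theta> v \<noteq> 0" for v
  proof (cases "v 0 = 0")
    case False
    then have "v 0 * v 0 > 0" by (metis mult_eq_0_iff not_real_square_gt_zero)
    moreover have "flat 1 (- 1 * v 0 + 1) \<ge> 0" by (simp add: flat_def)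
    ultimately show ?thesis unfolding \<theta>_def by linarith
  qed (simp add: \<theta>_def flat_def)
  show "(\<lambda>v. v 0 * (1 / \<theta> v)) \<in> Cinf 1"
    unfolding \<theta>_def[abs_def]
    by (intro Cinf_mult Cinf_recip Cinf_add Cinf_proj flat_affine_Cinf \<theta>[unfolded \<theta>_def]) simp_all
  show "(\<lambda>v. flat 1 (1 * v 0 + (- 1))) \<in> Cinf 1" by (rule flat_affine_Cinf)
  show "v 0 * (v 0 * (1 / \<theta> v)) * flat 1 (1 * v 0 + (- 1)) = flat 1 (1 * v 0 + (- 1))" for v
    using \<theta>[of v] by (auto simp: \<theta>_def flat_def)
qed (simp add: flat_def)

section \<open>The underlying algebra of a \<open>C\<^sup>\<infinity>\<close>-ring\<close>

abbreviation tuples :: "nat \<Rightarrow> 'a cinf_ring \<Rightarrow> (nat \<Rightarrow> 'a) set" where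
  "tuples n A \<equiv> {..<n} \<rightarrow> carrier A"

lemma carrier_alg [simp]: "carrier (alg A) = carrier A"
  by (simp add: alg_def)

context cinf_ring
begin

lemma oper_binary:
  assumes "f \<in> Cinf 2" "p \<in> Cinf n" "q \<in> Cinf n" "T \<in> tuples n A"
  shows "oper A 2 f (\<lambda>i. if i = 0 then oper A n p T else oper A n q T)
       = oper A n (\<lambda>v. f (\<lambda>j. if j = 0 then p v else q v)) T"
proof -
  define g where "g j = (if j = (0::nat) then p else q)" for j
  have "(\<lambda>j. oper A n (g j) T) = (\<lambda>i. if i = 0 then oper A n p T else oper A n q T)"
    and "(\<lambda>j. g j v) = (\<lambda>j. if j = 0 then p v else q v)" for v
    by (auto simp: g_def fun_eq_iff)
  moreover have "g j \<in> Cinf n" for j using assms(2,3) by (simp add: g_def)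
  then have "oper A n (\<lambda>v. f (\<lambda>j. g j v)) T = oper A 2 f (\<lambda>j. oper A n (g j) T)"
    by (intro oper_comp assms)
  ultimately show ?thesis by simp
qed

text \<open>
  Evaluation at a fixed tuple turns the pointwise algebra operations on \<open>Cinf n\<close> into those of
  \<open>A\<close>. Hence every polynomial identity between elements of \<open>A\<close> follows from the same identity
  between smooth functions.
\<close>

lemma eval_mult:
  "\<lbrakk>p \<in> Cinf n; q \<in> Cinf n; T \<in> tuples n A\<rbrakk> \<Longrightarrow>
    oper A n p T \<otimes>\<^bsub>alg A\<^esub> oper A n q T = oper A n (\<lambda>v. p v * q v) T"
  using oper_binary[of "\<lambda>v. v 0 * v 1" p n q T] by (simp add: alg_def)

lemma eval_add:
  "\<lbrakk>p \<in> Cinf n; q \<in> Cinf n; T \<in> tuples n A\<rbrakk> \<Longrightarrow>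
    oper A n p T \<oplus>\<^bsub>alg A\<^esub> oper A n q T = oper A n (\<lambda>v. p v + q v) T"
  using oper_binary[of "\<lambda>v. v 0 + v 1" p n q T] by (simp add: alg_def)

lemma eval_smult:
  "\<lbrakk>p \<in> Cinf n; T \<in> tuples n A\<rbrakk> \<Longrightarrow>
    r \<odot>\<^bsub>alg A\<^esub> oper A n p T = oper A n (\<lambda>v. r * p v) T"
  using oper_comp[of "\<lambda>v. r * v 0" 1 "\<lambda>j. p" n T] by (simp add: alg_def)

lemma eval_const:
  assumes "T \<in> tuples n A"
  shows "oper A n (\<lambda>v. c) T = oper A 0 (\<lambda>v. c) (\<lambda>i. undefined)"
proof -
  have "oper A n (\<lambda>v. c) T = oper A 0 (\<lambda>v. c) (\<lambda>j. oper A n (\<lambda>v. 0) T)"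
    using oper_comp[of "\<lambda>v. c" 0 "\<lambda>j v. 0" n T] assms by simp
  also have "\<dots> = oper A 0 (\<lambda>v. c) (\<lambda>i. undefined)"
    by (rule oper_cong) simp_all
  finally show ?thesis .
qed

lemma eval_one: "T \<in> tuples n A \<Longrightarrow> \<one>\<^bsub>alg A\<^esub> = oper A n (\<lambda>v. 1) T"
  unfolding alg_def by (simp add: eval_const[of T n])

lemma eval_zero: "T \<in> tuples n A \<Longrightarrow> \<zero>\<^bsub>alg A\<^esub> = oper A n (\<lambda>v. 0) T"
  unfolding alg_def by (simp add: eval_const[of T n])

lemmas eval_simps = eval_mult eval_add eval_smult

text \<open>
  Three elements suffice to state the axioms of a commutative ring.
\<close>

lemma eval_triple:
  assumes "a \<in> carrier A" "b \<in> carrier A" "c \<in> carrier A"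
  obtains T where "T \<in> tuples 3 A" "a = oper A 3 (\<lambda>v. v 0) T"
    "b = oper A 3 (\<lambda>v. v 1) T" "c = oper A 3 (\<lambda>v. v 2) T"
proof -
  define T where "T i = (if i = 0 then a else if i = 1 then b else c)" for i :: nat
  have T: "T \<in> tuples 3 A" using assms by (auto simp: T_def)
  have "oper A 3 (\<lambda>v. v i) T = T i" if "i < 3" for i
    using oper_proj[OF that T] .
  from this[of 0] this[of 1] this[of 2] show thesis
    by (intro that[OF T]) (simp_all add: T_def)
qed

lemma alg_mult_closed: "\<lbrakk>a \<in> carrier A; b \<in> carrier A\<rbrakk> \<Longrightarrow> a \<otimes>\<^bsub>alg A\<^esub> b \<in> carrier A"
  and alg_add_closed: "\<lbrakk>a \<in> carrier A; b \<in> carrier A\<rbrakk> \<Longrightarrow> a \<oplus>\<^bsub>alg A\<^esub> b \<in> carrier A"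
  and alg_smult_closed [simp, intro]: "a \<in> carrier A \<Longrightarrow> r \<odot>\<^bsub>alg A\<^esub> a \<in> carrier A"
  and alg_one_closed: "\<one>\<^bsub>alg A\<^esub> \<in> carrier A"
  and alg_zero_closed: "\<zero>\<^bsub>alg A\<^esub> \<in> carrier A"
  by (auto simp: alg_def intro!: oper_closed)

lemma cring_alg: "cring (alg A)"
proof (intro cringI abelian_groupI comm_monoidI, unfold carrier_alg)
  fix x y z assume "x \<in> carrier A" "y \<in> carrier A" "z \<in> carrier A"
  then obtain T where T: "T \<in> tuples 3 A" and xyz: "x = oper A 3 (\<lambda>v. v 0) T"
    "y = oper A 3 (\<lambda>v. v 1) T" "z = oper A 3 (\<lambda>v. v 2) T" by (rule eval_triple)
  show "(x \<oplus>\<^bsub>alg A\<^esub> y) \<oplus>\<^bsub>alg A\<^esub> z = x \<oplus>\<^bsub>alg A\<^esub> (y \<oplus>\<^bsub>alg A\<^esub> z)"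
    "(x \<otimes>\<^bsub>alg A\<^esub> y) \<otimes>\<^bsub>alg A\<^esub> z = x \<otimes>\<^bsub>alg A\<^esub> (y \<otimes>\<^bsub>alg A\<^esub> z)"
    "(x \<oplus>\<^bsub>alg A\<^esub> y) \<otimes>\<^bsub>alg A\<^esub> z = x \<otimes>\<^bsub>alg A\<^esub> z \<oplus>\<^bsub>alg A\<^esub> y \<otimes>\<^bsub>alg A\<^esub> z"
    unfolding xyz using T by (simp_all add: eval_simps algebra_simps)
next
  fix x y assume "x \<in> carrier A" "y \<in> carrier A"
  from eval_triple[OF this this(2)]
  obtain T where T: "T \<in> tuples 3 A" and xy: "x = oper A 3 (\<lambda>v. v 0) T"
    "y = oper A 3 (\<lambda>v. v 1) T" .
  show "x \<oplus>\<^bsub>alg A\<^esub> y = y \<oplus>\<^bsub>alg A\<^esub> x" "x \<otimes>\<^bsub>alg A\<^esub> y = y \<otimes>\<^bsub>alg A\<^esub> x"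
    unfolding xy using T by (simp_all add: eval_simps algebra_simps)
next
  fix x assume x: "x \<in> carrier A"
  from eval_triple[OF this this this]
  obtain T where T: "T \<in> tuples 3 A" and x': "x = oper A 3 (\<lambda>v. v 0) T" .
  show "\<zero>\<^bsub>alg A\<^esub> \<oplus>\<^bsub>alg A\<^esub> x = x" "\<one>\<^bsub>alg A\<^esub> \<otimes>\<^bsub>alg A\<^esub> x = x"
    unfolding x' eval_zero[OF T] eval_one[OF T] using T by (simp_all add: eval_simps)
  have "((- 1) \<odot>\<^bsub>alg A\<^esub> x) \<oplus>\<^bsub>alg A\<^esub> x = \<zero>\<^bsub>alg A\<^esub>"
    unfolding x' eval_zero[OF T] using T by (simp add: eval_simps)
  then show "\<exists>y\<in>carrier A. y \<oplus>\<^bsub>alg A\<^esub> x = \<zero>\<^bsub>alg A\<^esub>"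
    using alg_smult_closed[OF x] by (rule bexI)
qed (auto intro: alg_mult_closed alg_add_closed alg_one_closed alg_zero_closed)

sublocale AR: cring "alg A"
  rewrites "carrier (alg A) = carrier A"
  by (rule cring_alg) simp

end

section \<open>Homomorphisms\<close>

lemma cinf_hom_oper:
  "\<lbrakk>\<phi> \<in> cinf_hom A B; f \<in> Cinf n; a \<in> tuples n A\<rbrakk> \<Longrightarrow>
    \<phi> (oper A n f a) = oper B n f (\<lambda>i. \<phi> (a i))"
  by (simp add: cinf_hom_def)

lemma cinf_hom_closed: "\<lbrakk>\<phi> \<in> cinf_hom A B; a \<in> carrier A\<rbrakk> \<Longrightarrow> \<phi> a \<in> carrier B"
  by (auto simp: cinf_hom_def)

lemma cinf_hom_eqI:
  "\<lbrakk>\<phi> \<in> cinf_hom A B; \<psi> \<in> cinf_hom A B; \<And>a. a \<in> carrier A \<Longrightarrow> \<phi> a = \<psi> a\<rbrakk> \<Longrightarrow> \<phi> = \<psi>"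
  by (rule PiE_ext[of _ "carrier A" "\<lambda>_. carrier B"]) (simp_all add: cinf_hom_def)

lemma cinf_hom_id: "cinf_ring A \<Longrightarrow> (\<lambda>a\<in>carrier A. a) \<in> cinf_hom A A"
  unfolding cinf_hom_def
  by (auto simp: Pi_iff cinf_ring.oper_closed intro!: cinf_ring.oper_cong)

lemma cinf_hom_compose:
  assumes A: "cinf_ring A" and C: "cinf_ring C"
    and \<phi>: "\<phi> \<in> cinf_hom A B" and \<psi>: "\<psi> \<in> cinf_hom B C"
  shows "(\<lambda>a\<in>carrier A. \<psi> (\<phi> a)) \<in> cinf_hom A C"
proof -
  have closed: "\<psi> (\<phi> a) \<in> carrier C" if "a \<in> carrier A" for a
    by (intro cinf_hom_closed[OF \<psi>] cinf_hom_closed[OF \<phi>] that)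
  have "(\<lambda>a\<in>carrier A. \<psi> (\<phi> a)) (oper A n f a) = oper C n f (\<lambda>i. (\<lambda>a\<in>carrier A. \<psi> (\<phi> a)) (a i))"
    if f: "f \<in> Cinf n" and a: "a \<in> tuples n A" for n f a
  proof -
    have ai: "a i \<in> carrier A" if "i < n" for i using a that by auto
    then have "(\<lambda>i. \<phi> (a i)) \<in> tuples n B" by (auto intro: cinf_hom_closed[OF \<phi>])
    then have "\<psi> (\<phi> (oper A n f a)) = oper C n f (\<lambda>i. \<psi> (\<phi> (a i)))"
      by (simp add: cinf_hom_oper[OF \<phi> f a] cinf_hom_oper[OF \<psi> f])
    also have "\<dots> = oper C n f (\<lambda>i. (\<lambda>a\<in>carrier A. \<psi> (\<phi> a)) (a i))"
      using ai closed by (intro cinf_ring.oper_cong[OF C f]) auto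
    finally show ?thesis using cinf_ring.oper_closed[OF A f a] by simp
  qed
  with closed show ?thesis unfolding cinf_hom_def by simp
qed

locale cinf_hom_pair = A: cinf_ring A + B: cinf_ring B
  for A :: "'a cinf_ring" and B :: "'b cinf_ring" and \<phi> :: "'a \<Rightarrow> 'b" +
  assumes hom: "\<phi> \<in> cinf_hom A B"
begin

lemma closed [simp, intro]: "a \<in> carrier A \<Longrightarrow> \<phi> a \<in> carrier B"
  by (rule cinf_hom_closed[OF hom])

lemma hom_oper: "\<lbrakk>f \<in> Cinf n; a \<in> tuples n A\<rbrakk> \<Longrightarrow> \<phi> (oper A n f a) = oper B n f (\<lambda>i. \<phi> (a i))"
  by (rule cinf_hom_oper[OF hom])

lemma hom_smult: "a \<in> carrier A \<Longrightarrow> \<phi> (r \<odot>\<^bsub>alg A\<^esub> a) = r \<odot>\<^bsub>alg B\<^esub> \<phi> a"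
  using hom_oper[of "\<lambda>v. r * v 0" 1 "\<lambda>i. a"] by (simp add: alg_def)

lemma ring_hom_alg: "\<phi> \<in> ring_hom (alg A) (alg B)"
proof (rule ring_hom_memI, unfold carrier_alg)
  fix x y assume xy: "x \<in> carrier A" "y \<in> carrier A"
  have "(\<lambda>i. if i = (0::nat) then x else y) \<in> tuples 2 A" using xy by auto
  then show "\<phi> (x \<otimes>\<^bsub>alg A\<^esub> y) = \<phi> x \<otimes>\<^bsub>alg B\<^esub> \<phi> y" "\<phi> (x \<oplus>\<^bsub>alg A\<^esub> y) = \<phi> x \<oplus>\<^bsub>alg B\<^esub> \<phi> y"
    by (simp_all add: alg_def hom_oper if_distrib[where f = \<phi>])
next
  have "\<phi> \<one>\<^bsub>alg A\<^esub> = oper B 0 (\<lambda>v. 1) (\<lambda>i. \<phi> undefined)"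
    by (simp add: alg_def hom_oper)
  also have "\<dots> = \<one>\<^bsub>alg B\<^esub>" by (simp add: B.eval_one[of "\<lambda>i. \<phi> undefined" 0])
  finally show "\<phi> \<one>\<^bsub>alg A\<^esub> = \<one>\<^bsub>alg B\<^esub>" .
qed simp

sublocale H: ring_hom_cring "alg A" "alg B" \<phi>
  rewrites "carrier (alg A) = carrier A" and "carrier (alg B) = carrier B"
  by (intro ring_hom_cring.intro A.cring_alg B.cring_alg ring_hom_cring_axioms.intro ring_hom_alg)
     simp_all

end

section \<open>Localization as a quotient\<close>

context cinf_ring
begin

text \<open>
  By Hadamard's lemma \<open>f(T) - f(T(i := b)) = (T\<^sub>i - b) G\<close> in \<open>A\<close>, where \<open>G\<close> is the value of the Hadamard
  quotient at the tuple \<open>T\<close> with \<open>b\<close> appended. If \<open>d\<close> annihilates \<open>T\<^sub>i - b\<close>, it annihilates the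
  difference.
\<close>

lemma oper_change_coordinate:
  assumes f: "f \<in> Cinf n" and T: "T \<in> tuples n A" and i: "i < n"
    and b: "b \<in> carrier A" and d: "d \<in> carrier A"
    and eq: "T i \<otimes>\<^bsub>alg A\<^esub> d = b \<otimes>\<^bsub>alg A\<^esub> d"
  shows "oper A n f T \<otimes>\<^bsub>alg A\<^esub> d = oper A n f (T(i := b)) \<otimes>\<^bsub>alg A\<^esub> d"
proof -
  obtain g where g: "g \<in> Cinf (Suc n)"
    and fg: "\<And>v. f v = f (v(i := v n)) + (v i - v n) * g v"
    using Hadamard_coordinate[OF f i] by metis
  define T' where "T' = T(n := b)"
  have T': "T' \<in> tuples (Suc n) A"
    using T b by (auto simp: T'_def Pi_iff less_Suc_eq)
  \<comment> \<open>\<open>h\<close> is written as a composite with coordinate functions so that \<open>oper_comp\<close> computes its value.\<close>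
  define h where "h v = f (\<lambda>j. (if j = i then \<lambda>v. v n else (\<lambda>v. v j)) v)" for v
  have h_eq: "h v = f (v(i := v n))" for v
    unfolding h_def by (rule arg_cong[where f = f]) auto
  have fS: "f \<in> Cinf (Suc n)" using Cinf_mono[OF f] by simp
  have "h = (\<lambda>v. f v - (v i - v n) * g v)"
    using fg by (simp add: h_eq fun_eq_iff algebra_simps)
  then have hS: "h \<in> Cinf (Suc n)"
    using fS g i by simp
  have coord: "oper A (Suc n) (\<lambda>v. v j) T' = T' j" if "j < Suc n" for j
    using oper_proj[OF that T'] .
  have F: "oper A (Suc n) f T' = oper A n f T"
  proof -
    have "oper A (Suc n) (\<lambda>v. f (\<lambda>j. v j)) T' = oper A n f (\<lambda>j. oper A (Suc n) (\<lambda>v. v j) T')"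
      by (rule oper_comp[OF f _ T']) simp
    also have "\<dots> = oper A n f T"
      by (rule oper_cong[OF f]) (use coord T in \<open>auto simp: T'_def\<close>)
    finally show ?thesis by simp
  qed
  have H: "oper A (Suc n) h T' = oper A n f (T(i := b))"
  proof -
    have "oper A (Suc n) h T' =
        oper A n f (\<lambda>j. oper A (Suc n) (if j = i then \<lambda>v. v n else (\<lambda>v. v j)) T')"
      unfolding h_def by (rule oper_comp[OF f _ T']) (use i in auto)
    also have "\<dots> = oper A n f (T(i := b))"
      by (rule oper_cong[OF f]) (use coord T b in \<open>auto simp: T'_def\<close>)
    finally show ?thesis .
  qed
  define G where "G = oper A (Suc n) g T'"
  have G: "G \<in> carrier A" unfolding G_def using g T' by (rule oper_closed)
  have Ti: "T i \<in> carrier A" using T i by auto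
  let ?F = "oper A n f T" and ?H = "oper A n f (T(i := b))"
  have FH: "?F \<in> carrier A" "?H \<in> carrier A"
    using T b by (auto intro!: oper_closed[OF f] simp: Pi_iff)
  have "?F \<oplus>\<^bsub>alg A\<^esub> b \<otimes>\<^bsub>alg A\<^esub> G = ?H \<oplus>\<^bsub>alg A\<^esub> T i \<otimes>\<^bsub>alg A\<^esub> G"
  proof -
    have "f v + v n * g v = h v + v i * g v" for v
      using fg[of v] by (simp add: h_eq algebra_simps)
    then have "oper A (Suc n) f T' \<oplus>\<^bsub>alg A\<^esub> oper A (Suc n) (\<lambda>v. v n) T' \<otimes>\<^bsub>alg A\<^esub> G
        = oper A (Suc n) h T' \<oplus>\<^bsub>alg A\<^esub> oper A (Suc n) (\<lambda>v. v i) T' \<otimes>\<^bsub>alg A\<^esub> G"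
      unfolding G_def using fS hS g i T' by (simp add: eval_simps)
    then show ?thesis
      unfolding F H using i by (simp add: coord) (simp add: T'_def)
  qed
  then have "(?F \<oplus>\<^bsub>alg A\<^esub> b \<otimes>\<^bsub>alg A\<^esub> G) \<otimes>\<^bsub>alg A\<^esub> d = (?H \<oplus>\<^bsub>alg A\<^esub> T i \<otimes>\<^bsub>alg A\<^esub> G) \<otimes>\<^bsub>alg A\<^esub> d"
    by simp
  then have "?F \<otimes>\<^bsub>alg A\<^esub> d \<oplus>\<^bsub>alg A\<^esub> G \<otimes>\<^bsub>alg A\<^esub> (b \<otimes>\<^bsub>alg A\<^esub> d)
      = ?H \<otimes>\<^bsub>alg A\<^esub> d \<oplus>\<^bsub>alg A\<^esub> G \<otimes>\<^bsub>alg A\<^esub> (T i \<otimes>\<^bsub>alg A\<^esub> d)"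
    using FH G b d Ti by (simp add: AR.l_distr AR.r_distr AR.m_ac)
  then show ?thesis
    unfolding eq using FH G b d by (simp add: AR.add.right_cancel)
qed

end

text \<open>
  Multiplicative sets whose localization needs no new elements: each \<open>c\<close> in \<open>S\<close> already has an
  inverse \<open>b\<close> in \<open>A\<close> up to an element annihilated by some \<open>d\<close> in \<open>S\<close>.
\<close>

locale cinf_fractions = cinf_ring A for A :: "'a cinf_ring" +
  fixes S :: "'a set"
  assumes S_sub: "S \<subseteq> carrier A"
    and one_S: "\<one>\<^bsub>alg A\<^esub> \<in> S"
    and mult_S: "\<lbrakk>c \<in> S; d \<in> S\<rbrakk> \<Longrightarrow> c \<otimes>\<^bsub>alg A\<^esub> d \<in> S"
    and S_local_inverse: "c \<in> S \<Longrightarrow>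
      \<exists>b\<in>carrier A. \<exists>d\<in>S. c \<otimes>\<^bsub>alg A\<^esub> b \<otimes>\<^bsub>alg A\<^esub> d = d"
begin

definition rel :: "('a \<times> 'a) set" where
  "rel = {(a, b). a \<in> carrier A \<and> b \<in> carrier A \<and>
     (\<exists>d\<in>S. a \<otimes>\<^bsub>alg A\<^esub> d = b \<otimes>\<^bsub>alg A\<^esub> d)}"

lemma equiv_rel: "equiv (carrier A) rel"
proof (rule equivI)
  show "rel \<subseteq> carrier A \<times> carrier A" by (auto simp: rel_def)
  show "refl_on (carrier A) rel"
    using one_S by (auto simp: rel_def intro!: refl_onI)
  show "sym rel"
  proof (rule symI)
    fix a b assume "(a, b) \<in> rel"
    then obtain d where "a \<in> carrier A" "b \<in> carrier A" "d \<in> S" "a \<otimes>\<^bsub>alg A\<^esub> d = b \<otimes>\<^bsub>alg A\<^esub> d"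
      by (auto simp: rel_def)
    then show "(b, a) \<in> rel" by (auto simp: rel_def intro!: bexI[of _ d])
  qed
  show "trans rel"
  proof (rule transI)
    fix a b c assume "(a, b) \<in> rel" "(b, c) \<in> rel"
    then obtain d e where *: "a \<in> carrier A" "b \<in> carrier A" "c \<in> carrier A" "d \<in> S" "e \<in> S"
      and ad: "a \<otimes>\<^bsub>alg A\<^esub> d = b \<otimes>\<^bsub>alg A\<^esub> d" and be: "b \<otimes>\<^bsub>alg A\<^esub> e = c \<otimes>\<^bsub>alg A\<^esub> e"
      by (auto simp: rel_def)
    have de: "d \<in> carrier A" "e \<in> carrier A" using * S_sub by auto
    have "a \<otimes>\<^bsub>alg A\<^esub> (d \<otimes>\<^bsub>alg A\<^esub> e) = (a \<otimes>\<^bsub>alg A\<^esub> d) \<otimes>\<^bsub>alg A\<^esub> e"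
      using * de by (simp add: AR.m_assoc)
    also have "\<dots> = (b \<otimes>\<^bsub>alg A\<^esub> e) \<otimes>\<^bsub>alg A\<^esub> d"
      unfolding ad using * de by (simp add: AR.m_ac)
    also have "\<dots> = c \<otimes>\<^bsub>alg A\<^esub> (d \<otimes>\<^bsub>alg A\<^esub> e)"
      unfolding be using * de by (simp add: AR.m_ac)
    finally show "(a, c) \<in> rel"
      using * mult_S[of d e] by (auto simp: rel_def)
  qed
qed

text \<open>
  The coordinates are exchanged one after the other; \<open>c k\<close> has already received \<open>b\<close> in its first
  \<open>k\<close> places.
\<close>

lemma rel_oper:
  assumes f: "f \<in> Cinf n" and ab: "\<And>i. i < n \<Longrightarrow> (a i, b i) \<in> rel"
  shows "(oper A n f a, oper A n f b) \<in> rel"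
proof -
  have ca: "a i \<in> carrier A" and cb: "b i \<in> carrier A" if "i < n" for i
    using ab[OF that] by (auto simp: rel_def)
  define c where "c k i = (if i < k then b i else a i)" for k i
  have c: "c k \<in> tuples n A" for k using ca cb by (auto simp: c_def)
  have step: "(oper A n f (c k), oper A n f (c (Suc k))) \<in> rel" if k: "k < n" for k
  proof -
    obtain d where d: "d \<in> S" "a k \<otimes>\<^bsub>alg A\<^esub> d = b k \<otimes>\<^bsub>alg A\<^esub> d"
      using ab[OF k] by (auto simp: rel_def)
    have cS: "c (Suc k) = (c k)(k := b k)" by (auto simp: c_def fun_eq_iff)
    have "oper A n f (c k) \<otimes>\<^bsub>alg A\<^esub> d = oper A n f (c (Suc k)) \<otimes>\<^bsub>alg A\<^esub> d"
      unfolding cS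
      using d S_sub by (intro oper_change_coordinate[OF f c k cb[OF k]]) (auto simp: c_def)
    then show ?thesis
      using d oper_closed[OF f c] by (auto simp: rel_def)
  qed
  have "(oper A n f (c 0), oper A n f (c k)) \<in> rel" if "k \<le> n" for k
    using that
  proof (induction k)
    case 0
    show ?case using equiv_rel oper_closed[OF f c] by (meson equiv_def refl_onD)
  next
    case (Suc k)
    then have "(oper A n f (c 0), oper A n f (c k)) \<in> rel" by simp
    moreover have "(oper A n f (c k), oper A n f (c (Suc k))) \<in> rel"
      using Suc.prems by (intro step) simp
    ultimately show ?case using equiv_rel by (meson equiv_def transD)
  qed
  from this[of n] have "(oper A n f (c 0), oper A n f (c n)) \<in> rel" by simp
  moreover have "c 0 = a" by (simp add: c_def fun_eq_iff)
  moreover have "oper A n f (c n) = oper A n f b"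
    by (rule oper_cong[OF f c]) (simp add: c_def)
  ultimately show ?thesis by simp
qed

text \<open>
  Undefined outside the carrier because \<open>cinf_hom\<close> consists of extensional functions.
\<close>

definition cls :: "'a \<Rightarrow> 'a set" where
  "cls a = (if a \<in> carrier A then rel `` {a} else undefined)"

definition rep :: "'a set \<Rightarrow> 'a" where
  "rep c = (SOME a. a \<in> carrier A \<and> cls a = c)"

definition quot :: "'a set cinf_ring" where
  "quot = \<lparr>carrier = cls ` carrier A, oper = (\<lambda>n f c. cls (oper A n f (\<lambda>i. rep (c i))))\<rparr>"

lemma cls_eq_iff: "\<lbrakk>a \<in> carrier A; b \<in> carrier A\<rbrakk> \<Longrightarrow> cls a = cls b \<longleftrightarrow> (a, b) \<in> rel"
  by (simp add: cls_def eq_equiv_class_iff[OF equiv_rel])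

lemma rep: "c \<in> carrier quot \<Longrightarrow> rep c \<in> carrier A \<and> cls (rep c) = c"
  unfolding rep_def by (rule someI_ex) (auto simp: quot_def)

lemma quot_oper:
  assumes "f \<in> Cinf n" "a \<in> tuples n A"
  shows "oper quot n f (\<lambda>i. cls (a i)) = cls (oper A n f a)"
proof -
  have *: "(rep (cls (a i)), a i) \<in> rel" if "i < n" for i
  proof -
    have ai: "a i \<in> carrier A" using assms(2) that by auto
    then have "cls (a i) \<in> carrier quot" by (simp add: quot_def)
    from rep[OF this] ai show ?thesis using cls_eq_iff[of "rep (cls (a i))" "a i"] by simp
  qed
  have "(\<lambda>i. rep (cls (a i))) \<in> tuples n A" using * by (auto simp: rel_def)
  with rel_oper[OF assms(1) *] assms show ?thesis
    by (simp add: quot_def cls_eq_iff oper_closed)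
qed

lemma quot_cinf_ring: "cinf_ring quot"
proof
  fix f n c assume f: "f \<in> Cinf n" and c: "c \<in> tuples n quot"
  have r: "(\<lambda>i. rep (c i)) \<in> tuples n A" using rep c by auto
  show "oper quot n f c \<in> carrier quot"
    using oper_closed[OF f r] by (simp add: quot_def)
  fix d assume "\<And>i. i < n \<Longrightarrow> c i = d i"
  then show "oper quot n f c = oper quot n f d"
    using oper_cong[OF f r, of "\<lambda>i. rep (d i)"] by (simp add: quot_def)
next
  fix i n c assume i: "i < n" and c: "c \<in> tuples n quot"
  have r: "(\<lambda>i. rep (c i)) \<in> tuples n A" using rep c by auto
  show "oper quot n (\<lambda>v. v i) c = c i"
    using oper_proj[OF i r] rep[of "c i"] c i by (auto simp: quot_def)
next
  fix f m g n c assume f: "f \<in> Cinf m" and g: "\<And>j. j < m \<Longrightarrow> g j \<in> Cinf n"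
    and c: "c \<in> tuples n quot"
  have r: "(\<lambda>i. rep (c i)) \<in> tuples n A" using rep c by auto
  have gA: "(\<lambda>j. oper A n (g j) (\<lambda>i. rep (c i))) \<in> tuples m A"
    using oper_closed[OF g r] by auto
  show "oper quot n (\<lambda>v. f (\<lambda>j. g j v)) c = oper quot m f (\<lambda>j. oper quot n (g j) c)"
    using quot_oper[OF f gA] oper_comp[OF f g r] by (simp add: quot_def)
qed

lemma cls_hom: "cls \<in> cinf_hom A quot"
proof -
  have "cls \<in> carrier A \<rightarrow>\<^sub>E carrier quot" by (auto simp: quot_def cls_def)
  then show ?thesis by (simp add: cinf_hom_def quot_oper)
qed

sublocale cls: cinf_hom_pair A quot cls
  by (intro cinf_hom_pair.intro quot_cinf_ring cinf_ring_axioms cinf_hom_pair_axioms.intro cls_hom)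

text \<open>
  The condition on \<open>S\<close> says exactly that \<open>c b \<sim> 1\<close>.
\<close>

lemma cls_S_Units: "cls ` S \<subseteq> Units (alg quot)"
proof
  fix u assume "u \<in> cls ` S"
  then obtain c where c: "c \<in> S" "u = cls c" by blast
  then obtain b d where b: "b \<in> carrier A" and d: "d \<in> S"
    and bd: "c \<otimes>\<^bsub>alg A\<^esub> b \<otimes>\<^bsub>alg A\<^esub> d = d" using S_local_inverse by blast
  have C: "c \<in> carrier A" "d \<in> carrier A" using c d S_sub by auto
  then have "c \<otimes>\<^bsub>alg A\<^esub> b \<otimes>\<^bsub>alg A\<^esub> d = \<one>\<^bsub>alg A\<^esub> \<otimes>\<^bsub>alg A\<^esub> d" using bd by simp
  with C b d have "(c \<otimes>\<^bsub>alg A\<^esub> b, \<one>\<^bsub>alg A\<^esub>) \<in> rel"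
    by (auto simp: rel_def intro!: bexI[of _ d])
  then have "cls (c \<otimes>\<^bsub>alg A\<^esub> b) = cls \<one>\<^bsub>alg A\<^esub>"
    using C b by (intro iffD2[OF cls_eq_iff]) auto
  then have "cls c \<otimes>\<^bsub>alg quot\<^esub> cls b = \<one>\<^bsub>alg quot\<^esub>" using C b by simp
  moreover from this have "cls b \<otimes>\<^bsub>alg quot\<^esub> cls c = \<one>\<^bsub>alg quot\<^esub>"
    using C b cls.B.AR.m_comm by simp
  ultimately show "u \<in> Units (alg quot)"
    using C b c by (auto simp: Units_def)
qed

text \<open>
  If \<open>a d = b d\<close> with \<open>d\<close> in \<open>S\<close>, then \<open>\<phi> a = \<phi> b\<close>, since \<open>\<phi> d\<close> can be cancelled. So \<open>\<phi>\<close> factors through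
  the quotient.
\<close>

lemma quot_universal:
  assumes B: "cinf_ring B" and \<phi>: "\<phi> \<in> cinf_hom A B" and units: "\<phi> ` S \<subseteq> Units (alg B)"
  shows "\<exists>!\<psi>. \<psi> \<in> cinf_hom quot B \<and> (\<forall>a\<in>carrier A. \<psi> (cls a) = \<phi> a)"
proof (rule ex_ex1I)
  interpret \<phi>: cinf_hom_pair A B \<phi>
    by (intro cinf_hom_pair.intro B cinf_ring_axioms cinf_hom_pair_axioms.intro \<phi>)
  have eq: "\<phi> a = \<phi> b" if "(a, b) \<in> rel" for a b
  proof -
    obtain d where d: "d \<in> S" "a \<otimes>\<^bsub>alg A\<^esub> d = b \<otimes>\<^bsub>alg A\<^esub> d" and ab: "a \<in> carrier A" "b \<in> carrier A"
      using \<open>(a, b) \<in> rel\<close> by (auto simp: rel_def)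
    have dc: "d \<in> carrier A" using d S_sub by auto
    from units d obtain e where e: "e \<in> carrier B" "\<phi> d \<otimes>\<^bsub>alg B\<^esub> e = \<one>\<^bsub>alg B\<^esub>"
      by (auto simp: Units_def)
    have "\<phi> a \<otimes>\<^bsub>alg B\<^esub> \<phi> d = \<phi> b \<otimes>\<^bsub>alg B\<^esub> \<phi> d"
      using d(2) ab dc \<phi>.H.hom_mult by metis
    then have "(\<phi> a \<otimes>\<^bsub>alg B\<^esub> \<phi> d) \<otimes>\<^bsub>alg B\<^esub> e = (\<phi> b \<otimes>\<^bsub>alg B\<^esub> \<phi> d) \<otimes>\<^bsub>alg B\<^esub> e"
      by simp
    then show ?thesis using ab dc e by (simp add: \<phi>.B.AR.m_assoc)
  qed
  define \<psi> where "\<psi> = (\<lambda>c\<in>carrier quot. \<phi> (rep c))"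
  have \<psi>: "\<psi> (cls a) = \<phi> a" if "a \<in> carrier A" for a
    using rep[of "cls a"] that by (auto simp: \<psi>_def cls_eq_iff intro!: eq)
  have "\<psi> (oper quot n f c) = oper B n f (\<lambda>i. \<psi> (c i))"
    if f: "f \<in> Cinf n" and c: "c \<in> tuples n quot" for n f c
  proof -
    have r: "(\<lambda>i. rep (c i)) \<in> tuples n A" using rep c by auto
    have "\<psi> (oper quot n f c) = \<phi> (oper A n f (\<lambda>i. rep (c i)))"
      using \<psi>[OF oper_closed[OF f r]] by (simp add: quot_def)
    also have "\<dots> = oper B n f (\<lambda>i. \<phi> (rep (c i)))"
      by (rule \<phi>.hom_oper[OF f r])
    also have "\<dots> = oper B n f (\<lambda>i. \<psi> (c i))"
      using r c by (intro \<phi>.B.oper_cong[OF f]) (auto simp: \<psi>_def)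
    finally show ?thesis .
  qed
  moreover have "\<psi> \<in> carrier quot \<rightarrow>\<^sub>E carrier B"
    using rep by (auto simp: \<psi>_def)
  ultimately have "\<psi> \<in> cinf_hom quot B" by (simp add: cinf_hom_def)
  with \<psi> show "\<exists>\<psi>. \<psi> \<in> cinf_hom quot B \<and> (\<forall>a\<in>carrier A. \<psi> (cls a) = \<phi> a)"
    by (intro exI[of _ \<psi>]) simp
next
  fix \<psi> \<psi>' assume *: "\<psi> \<in> cinf_hom quot B \<and> (\<forall>a\<in>carrier A. \<psi> (cls a) = \<phi> a)"
    "\<psi>' \<in> cinf_hom quot B \<and> (\<forall>a\<in>carrier A. \<psi>' (cls a) = \<phi> a)"
  show "\<psi> = \<psi>'"
  proof (rule cinf_hom_eqI)
    show "\<psi> \<in> cinf_hom quot B" "\<psi>' \<in> cinf_hom quot B" using * by simp_all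
    fix c assume "c \<in> carrier quot"
    then obtain a where "a \<in> carrier A" "c = cls a" by (auto simp: quot_def)
    with * show "\<psi> c = \<psi>' c" by simp
  qed
qed

lemma quot_is_localization: "is_localization t A S quot cls"
  unfolding is_localization_def
  by (intro conjI allI impI ballI quot_cinf_ring cls_hom cls_S_Units quot_universal)

text \<open>
  The universal properties of \<open>L\<close> and of the quotient give mutually inverse maps under \<open>A\<close>, so \<open>L\<close>
  inherits surjectivity and the kernel from the quotient.
\<close>

lemma localization_kernel:
  fixes L :: "'a set cinf_ring"
  assumes "is_localization TYPE('a set) A S L \<pi>"
  shows "carrier L = \<pi> ` carrier A"
    and "\<lbrakk>a \<in> carrier A; b \<in> carrier A\<rbrakk> \<Longrightarrow> \<pi> a = \<pi> b \<longleftrightarrow> (a, b) \<in> rel"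
proof -
  have L: "cinf_ring L" and \<pi>: "\<pi> \<in> cinf_hom A L" and \<pi>S: "\<pi> ` S \<subseteq> Units (alg L)"
    and univ: "\<And>B \<phi>. \<lbrakk>cinf_ring (B :: 'a set cinf_ring); \<phi> \<in> cinf_hom A B; \<phi> ` S \<subseteq> Units (alg B)\<rbrakk>
      \<Longrightarrow> \<exists>!\<psi>. \<psi> \<in> cinf_hom L B \<and> (\<forall>a\<in>carrier A. \<psi> (\<pi> a) = \<phi> a)"
    using assms unfolding is_localization_def by simp_all
  obtain \<psi> where \<psi>: "\<psi> \<in> cinf_hom L quot" "\<And>a. a \<in> carrier A \<Longrightarrow> \<psi> (\<pi> a) = cls a"
    using ex1_implies_ex[OF univ[OF quot_cinf_ring cls_hom cls_S_Units]] by auto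
  obtain \<kappa> where \<kappa>: "\<kappa> \<in> cinf_hom quot L" "\<And>a. a \<in> carrier A \<Longrightarrow> \<kappa> (cls a) = \<pi> a"
    using ex1_implies_ex[OF quot_universal[OF L \<pi> \<pi>S]] by auto
  have \<pi>c: "\<pi> a \<in> carrier L" if "a \<in> carrier A" for a by (rule cinf_hom_closed[OF \<pi> that])
  have "(\<lambda>l\<in>carrier L. \<kappa> (\<psi> l)) = (\<lambda>l\<in>carrier L. l)"
  proof (rule ex1E[OF univ[OF L \<pi> \<pi>S]])
    fix \<theta> assume "\<forall>\<theta>'. \<theta>' \<in> cinf_hom L L \<and> (\<forall>a\<in>carrier A. \<theta>' (\<pi> a) = \<pi> a) \<longrightarrow> \<theta>' = \<theta>"
    then have *: "\<theta>' = \<theta>" if "\<theta>' \<in> cinf_hom L L" "\<And>a. a \<in> carrier A \<Longrightarrow> \<theta>' (\<pi> a) = \<pi> a" for \<theta>'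
      using that by simp
    have "(\<lambda>l\<in>carrier L. \<kappa> (\<psi> l)) = \<theta>"
      by (rule *[OF cinf_hom_compose[OF L L \<psi>(1) \<kappa>(1)]]) (simp add: \<pi>c \<psi>(2) \<kappa>(2))
    moreover have "(\<lambda>l\<in>carrier L. l) = \<theta>"
      by (rule *[OF cinf_hom_id[OF L]]) (simp add: \<pi>c)
    ultimately show ?thesis by simp
  qed
  then have inv: "\<kappa> (\<psi> l) = l" if "l \<in> carrier L" for l
    using that by (metis restrict_apply')
  show "carrier L = \<pi> ` carrier A"
  proof
    show "carrier L \<subseteq> \<pi> ` carrier A"
    proof
      fix l assume l: "l \<in> carrier L"
      then have "\<psi> l \<in> carrier quot" by (rule cinf_hom_closed[OF \<psi>(1)])
      then obtain a where a: "a \<in> carrier A" "\<psi> l = cls a" by (auto simp: quot_def)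
      then show "l \<in> \<pi> ` carrier A" using inv[OF l] \<kappa>(2)[OF a(1)] by auto
    qed
  qed (use \<pi>c in auto)
  show "\<pi> a = \<pi> b \<longleftrightarrow> (a, b) \<in> rel" if ab: "a \<in> carrier A" "b \<in> carrier A"
    using \<psi>(2)[OF ab(1)] \<psi>(2)[OF ab(2)] \<kappa>(2)[OF ab(1)] \<kappa>(2)[OF ab(2)] cls_eq_iff[OF ab] by metis
qed

lemma localization_eq:
  obtains L :: "'a set cinf_ring" and \<pi> where "localization A S = (L, \<pi>)" "is_localization TYPE('a set) A S L \<pi>"
proof -
  have "\<exists>p. case p of (L :: 'a set cinf_ring, \<pi>) \<Rightarrow> is_localization TYPE('a set) A S L \<pi>"
    by (rule exI[of _ "(quot, cls)"]) (simp add: quot_is_localization)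
  from someI_ex[OF this]
  have "case localization A S of (L, \<pi>) \<Rightarrow> is_localization TYPE('a set) A S L \<pi>"
    unfolding localization_def .
  then show thesis using that by (cases "localization A S") auto
qed

end

section \<open>Localization at a point\<close>

lemma real_cinf_ring: "cinf_ring real_cinf"
  by unfold_locales (auto simp: real_cinf_def elim: Cinf_dep)

lemma alg_real_cinf [simp]:
  "a \<otimes>\<^bsub>alg real_cinf\<^esub> b = a * b" "a \<oplus>\<^bsub>alg real_cinf\<^esub> b = a + b"
  "r \<odot>\<^bsub>alg real_cinf\<^esub> a = r * a" "\<one>\<^bsub>alg real_cinf\<^esub> = 1" "\<zero>\<^bsub>alg real_cinf\<^esub> = 0"
  by (simp_all add: alg_def real_cinf_def)

context cinf_ring
begin

lemma smult_mult_left: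
  assumes "a \<in> carrier A" "b \<in> carrier A"
  shows "r \<odot>\<^bsub>alg A\<^esub> (a \<otimes>\<^bsub>alg A\<^esub> b) = (r \<odot>\<^bsub>alg A\<^esub> a) \<otimes>\<^bsub>alg A\<^esub> b"
proof -
  from eval_triple[OF assms assms(2)]
  obtain T where T: "T \<in> tuples 3 A" and ab: "a = oper A 3 (\<lambda>v. v 0) T" "b = oper A 3 (\<lambda>v. v 1) T" .
  show ?thesis unfolding ab using T by (simp add: eval_simps ac_simps)
qed

end

locale cinf_point = cinf_ring A for A :: "'a cinf_ring" +
  fixes x :: "'a \<Rightarrow> real"
  assumes x_point: "x \<in> points A"
begin

sublocale x: cinf_hom_pair A real_cinf x
  using x_point real_cinf_ring
  by (intro cinf_hom_pair.intro cinf_ring_axioms cinf_hom_pair_axioms.intro) (auto simp: points_def)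

lemma x_mult: "\<lbrakk>a \<in> carrier A; b \<in> carrier A\<rbrakk> \<Longrightarrow> x (a \<otimes>\<^bsub>alg A\<^esub> b) = x a * x b"
  and x_add: "\<lbrakk>a \<in> carrier A; b \<in> carrier A\<rbrakk> \<Longrightarrow> x (a \<oplus>\<^bsub>alg A\<^esub> b) = x a + x b"
  and x_smult: "a \<in> carrier A \<Longrightarrow> x (r \<odot>\<^bsub>alg A\<^esub> a) = r * x a"
  and x_one: "x \<one>\<^bsub>alg A\<^esub> = 1"
  by (simp_all add: x.hom_smult)

text \<open>
  The element \<open>a = 2 c\<^sup>2 / x(c)\<^sup>2\<close> has value \<open>2\<close> at \<open>x\<close>. With the functions \<open>g\<close> and \<open>\<rho>\<close> of a local
  reciprocal, \<open>a g(a) \<rho>(a) = \<rho>(a)\<close> and \<open>\<rho>(a)\<close> does not vanish at \<open>x\<close>; one factor \<open>c\<close> of \<open>a\<close> is split off.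
\<close>

lemma local_inverse:
  assumes c: "c \<in> carrier A" "x c \<noteq> 0"
  shows "\<exists>b\<in>carrier A. \<exists>d\<in>carrier A. x d \<noteq> 0 \<and> c \<otimes>\<^bsub>alg A\<^esub> b \<otimes>\<^bsub>alg A\<^esub> d = d"
proof -
  obtain g \<rho> where g: "g \<in> Cinf 1" and \<rho>: "\<rho> \<in> Cinf 1"
    and g\<rho>: "\<And>v. v 0 * g v * \<rho> v = \<rho> v" and \<rho>2: "\<And>v. v 0 = 2 \<Longrightarrow> \<rho> v \<noteq> 0"
    using local_reciprocal by metis
  define r where "r = 2 / (x c * x c)"
  define T where "T = (\<lambda>i::nat. r \<odot>\<^bsub>alg A\<^esub> (c \<otimes>\<^bsub>alg A\<^esub> c))"
  have T: "T \<in> tuples 1 A" using c by (auto simp: T_def)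
  define G where "G = oper A 1 g T"
  define D where "D = oper A 1 \<rho> T"
  have GD: "G \<in> carrier A" "D \<in> carrier A"
    unfolding G_def D_def using oper_closed g \<rho> T by blast+
  have "x (T i) = 2" for i using c by (simp add: T_def x_smult x_mult r_def)
  then have "x D = \<rho> (\<lambda>i. 2)"
    unfolding D_def using x.hom_oper[OF \<rho> T] by (simp add: real_cinf_def)
  then have "x D \<noteq> 0" using \<rho>2 by simp
  moreover have "c \<otimes>\<^bsub>alg A\<^esub> (r \<odot>\<^bsub>alg A\<^esub> (c \<otimes>\<^bsub>alg A\<^esub> G)) \<otimes>\<^bsub>alg A\<^esub> D = D"
  proof -
    have "c \<otimes>\<^bsub>alg A\<^esub> (r \<odot>\<^bsub>alg A\<^esub> (c \<otimes>\<^bsub>alg A\<^esub> G)) = T 0 \<otimes>\<^bsub>alg A\<^esub> G"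
      using c GD by (simp add: T_def smult_mult_left AR.m_assoc AR.m_lcomm)
    also have "T 0 = oper A 1 (\<lambda>v. v 0) T" using oper_proj[OF _ T, of 0] by simp
    finally have "c \<otimes>\<^bsub>alg A\<^esub> (r \<odot>\<^bsub>alg A\<^esub> (c \<otimes>\<^bsub>alg A\<^esub> G)) \<otimes>\<^bsub>alg A\<^esub> D
        = oper A 1 (\<lambda>v. v 0 * g v * \<rho> v) T"
      using g \<rho> T by (simp add: G_def D_def eval_simps)
    then show ?thesis unfolding g\<rho> D_def .
  qed
  ultimately show ?thesis
    using c GD by (intro bexI[of _ "r \<odot>\<^bsub>alg A\<^esub> (c \<otimes>\<^bsub>alg A\<^esub> G)"] bexI[of _ D]) auto
qed

sublocale fr: cinf_fractions A "{a \<in> carrier A. x a \<noteq> 0}"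
proof
  show "\<exists>b\<in>carrier A. \<exists>d\<in>{a \<in> carrier A. x a \<noteq> 0}. c \<otimes>\<^bsub>alg A\<^esub> b \<otimes>\<^bsub>alg A\<^esub> d = d"
    if "c \<in> {a \<in> carrier A. x a \<noteq> 0}" for c
    using local_inverse[of c] that by auto
qed (auto simp: x_mult x_one simp del: x.H.hom_mult x.H.hom_one)

lemma loc_localization:
  "is_localization TYPE('a set) A {a \<in> carrier A. x a \<noteq> 0} (loc_at A x) (loc_map A x)"
proof -
  obtain L :: "'a set cinf_ring" and \<pi> where "localization A {a \<in> carrier A. x a \<noteq> 0} = (L, \<pi>)"
    and "is_localization TYPE('a set) A {a \<in> carrier A. x a \<noteq> 0} L \<pi>"
    by (rule fr.localization_eq)
  then show ?thesis by (simp add: loc_at_def loc_map_def)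
qed

sublocale loc: cinf_hom_pair A "loc_at A x" "loc_map A x"
proof -
  note L = loc_localization[unfolded is_localization_def]
  have "cinf_ring (loc_at A x)" "loc_map A x \<in> cinf_hom A (loc_at A x)"
    by (rule conjunct1[OF L], rule conjunct1[OF conjunct2[OF L]])
  then show "cinf_hom_pair A (loc_at A x) (loc_map A x)"
    by (intro cinf_hom_pair.intro cinf_ring_axioms cinf_hom_pair_axioms.intro)
qed

lemma loc_at_carrier: "carrier (loc_at A x) = loc_map A x ` carrier A"
  by (rule fr.localization_kernel(1)[OF loc_localization])

definition lift :: "'a set \<Rightarrow> 'a" where
  "lift l = (SOME a. a \<in> carrier A \<and> loc_map A x a = l)"

lemma lift: "l \<in> carrier (loc_at A x) \<Longrightarrow> lift l \<in> carrier A \<and> loc_map A x (lift l) = l"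
  unfolding lift_def by (rule someI_ex) (auto simp: loc_at_carrier)

lemma loc_map_eq_iff:
  assumes "a \<in> carrier A" "b \<in> carrier A"
  shows "loc_map A x a = loc_map A x b \<longleftrightarrow>
    (\<exists>d\<in>carrier A. x d \<noteq> 0 \<and> a \<otimes>\<^bsub>alg A\<^esub> d = b \<otimes>\<^bsub>alg A\<^esub> d)"
  using fr.localization_kernel(2)[OF loc_localization assms] assms by (auto simp: fr.rel_def)

lemma loc_map_Unit:
  assumes "a \<in> carrier A" "x a \<noteq> 0"
  shows "loc_map A x a \<in> Units (alg (loc_at A x))"
proof -
  have "loc_map A x ` {a \<in> carrier A. x a \<noteq> 0} \<subseteq> Units (alg (loc_at A x))"
    using loc_localization unfolding is_localization_def by (elim conjE)
  with assms show ?thesis by auto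
qed

lemma loc_at_point_exists: "\<exists>p \<in> cinf_hom (loc_at A x) real_cinf. \<forall>a\<in>carrier A. p (loc_map A x a) = x a"
proof -
  have eq: "x a = x b" if ab: "a \<in> carrier A" "b \<in> carrier A" "loc_map A x a = loc_map A x b" for a b
  proof -
    obtain d where d: "d \<in> carrier A" "x d \<noteq> 0" "a \<otimes>\<^bsub>alg A\<^esub> d = b \<otimes>\<^bsub>alg A\<^esub> d"
      using ab loc_map_eq_iff by auto
    then have "x a * x d = x b * x d" using ab x_mult by metis
    with d show ?thesis by simp
  qed
  define p where "p = (\<lambda>l\<in>carrier (loc_at A x). x (lift l))"
  have p: "p (loc_map A x a) = x a" if "a \<in> carrier A" for a
    using that lift[of "loc_map A x a"] by (auto simp: p_def intro!: eq)
  have "p (oper (loc_at A x) n f l) = oper real_cinf n f (\<lambda>i. p (l i))"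
    if f: "f \<in> Cinf n" and l: "l \<in> tuples n (loc_at A x)" for n f l
  proof -
    have r: "(\<lambda>i. lift (l i)) \<in> tuples n A" using lift l by auto
    have "oper (loc_at A x) n f l = oper (loc_at A x) n f (\<lambda>i. loc_map A x (lift (l i)))"
      using lift l by (intro loc.B.oper_cong[OF f l]) auto
    also have "\<dots> = loc_map A x (oper A n f (\<lambda>i. lift (l i)))"
      by (rule loc.hom_oper[OF f r, symmetric])
    finally have "p (oper (loc_at A x) n f l) = oper real_cinf n f (\<lambda>i. x (lift (l i)))"
      using p[OF oper_closed[OF f r]] x.hom_oper[OF f r] by simp
    also have "\<dots> = oper real_cinf n f (\<lambda>i. p (l i))"
      using l by (intro x.B.oper_cong[OF f]) (auto simp: p_def real_cinf_def)
    finally show ?thesis .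
  qed
  moreover have "p \<in> carrier (loc_at A x) \<rightarrow>\<^sub>E carrier real_cinf" by (simp add: p_def real_cinf_def)
  ultimately have "p \<in> cinf_hom (loc_at A x) real_cinf" by (simp add: cinf_hom_def)
  with p show ?thesis by auto
qed

text \<open>
  Otherwise \<open>c = a - p(\<pi>\<^sub>x a)\<close> would not vanish at \<open>x\<close>, hence be a unit in \<open>A\<^sub>x\<close>, although \<open>p\<close> sends it
  to \<open>0\<close>.
\<close>

lemma loc_at_point_over:
  assumes p: "p \<in> cinf_hom (loc_at A x) real_cinf" and a: "a \<in> carrier A"
  shows "p (loc_map A x a) = x a"
proof (rule ccontr)
  assume neq: "p (loc_map A x a) \<noteq> x a"
  interpret p: cinf_hom_pair "loc_at A x" real_cinf p
    by (intro cinf_hom_pair.intro loc.B.cinf_ring_axioms real_cinf_ring cinf_hom_pair_axioms.intro p)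
  define c where "c = a \<oplus>\<^bsub>alg A\<^esub> ((- p (loc_map A x a)) \<odot>\<^bsub>alg A\<^esub> \<one>\<^bsub>alg A\<^esub>)"
  have c: "c \<in> carrier A" using a by (simp add: c_def)
  have "x c \<noteq> 0" using neq a by (simp add: c_def x_add x_smult x_one)
  from loc_map_Unit[OF c this] obtain u where u: "u \<in> carrier (loc_at A x)"
    "loc_map A x c \<otimes>\<^bsub>alg (loc_at A x)\<^esub> u = \<one>\<^bsub>alg (loc_at A x)\<^esub>" by (auto simp: Units_def)
  have "p (loc_map A x c) = p (loc_map A x a) + - p (loc_map A x a) * 1"
    using a by (simp add: c_def loc.hom_smult p.hom_smult)
  then have "p (loc_map A x c) = 0" by simp
  moreover have "p (loc_map A x c) * p u = 1"
    using arg_cong[OF u(2), of p] u(1) c by simp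
  ultimately show False by simp
qed

lemma loc_at_local: "local_cinf_ring (loc_at A x)"
  unfolding local_cinf_ring_def
proof (intro conjI ex_ex1I)
  show "cinf_ring (loc_at A x)" by (rule loc.B.cinf_ring_axioms)
  show "\<exists>p. p \<in> cinf_hom (loc_at A x) real_cinf" using loc_at_point_exists by auto
  fix p q assume pq: "p \<in> cinf_hom (loc_at A x) real_cinf" "q \<in> cinf_hom (loc_at A x) real_cinf"
  show "p = q"
  proof (rule cinf_hom_eqI[OF pq])
    fix l assume "l \<in> carrier (loc_at A x)"
    then obtain a where "a \<in> carrier A" "l = loc_map A x a" by (auto simp: loc_at_carrier)
    with loc_at_point_over[OF pq(1)] loc_at_point_over[OF pq(2)] show "p l = q l" by simp
  qed
qed

end

section \<open>The topology of the spectrum\<close>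

context cinf_ring
begin

lemma point: "x \<in> points A \<Longrightarrow> cinf_point A x"
  by (simp add: cinf_point_def cinf_point_axioms_def cinf_ring_axioms)

lemma basic_open_Int:
  assumes "a \<in> carrier A" "b \<in> carrier A"
  shows "basic_open A a \<inter> basic_open A b = basic_open A (a \<otimes>\<^bsub>alg A\<^esub> b)"
proof (rule Set.set_eqI)
  show "x \<in> basic_open A a \<inter> basic_open A b \<longleftrightarrow> x \<in> basic_open A (a \<otimes>\<^bsub>alg A\<^esub> b)" for x
  proof (cases "x \<in> points A")
    case True
    with cinf_point.x_mult[OF point[OF True] assms] show ?thesis by (simp add: basic_open_def)
  qed (simp add: basic_open_def)
qed

lemma basic_open_one: "basic_open A \<one>\<^bsub>alg A\<^esub> = points A"
proof (rule Set.set_eqI)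
  show "x \<in> basic_open A \<one>\<^bsub>alg A\<^esub> \<longleftrightarrow> x \<in> points A" for x
    using cinf_point.x_one[OF point, of x] by (cases "x \<in> points A") (simp_all add: basic_open_def)
qed

lemma openin_Spec_top:
  "openin (Spec_top A) U \<longleftrightarrow>
    (\<forall>x\<in>U. \<exists>a\<in>carrier A. x \<in> basic_open A a \<and> basic_open A a \<subseteq> U)"
proof -
  let ?P = "\<lambda>U. \<exists>a\<in>carrier A. U = basic_open A a"
  have "istopology (arbitrary union_of ?P)"
  proof (rule istopology_base)
    fix S T assume "?P S" "?P T"
    then obtain a b where "a \<in> carrier A" "b \<in> carrier A" "S = basic_open A a" "T = basic_open A b"
      by auto
    then show "?P (S \<inter> T)" by (intro bexI[of _ "a \<otimes>\<^bsub>alg A\<^esub> b"]) (auto simp: basic_open_Int)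
  qed
  then have "openin (Spec_top A) = arbitrary union_of ?P"
    unfolding Spec_top_def by (rule topology_inverse')
  then have "openin (Spec_top A) U \<longleftrightarrow> (\<forall>x\<in>U. \<exists>V. ?P V \<and> x \<in> V \<and> V \<subseteq> U)"
    by (simp add: arbitrary_union_of_alt)
  also have "\<dots> \<longleftrightarrow> (\<forall>x\<in>U. \<exists>a\<in>carrier A. x \<in> basic_open A a \<and> basic_open A a \<subseteq> U)"
    by (intro ball_cong refl) metis
  finally show ?thesis .
qed

lemma openin_basic_open: "a \<in> carrier A \<Longrightarrow> openin (Spec_top A) (basic_open A a)"
  by (auto simp: openin_Spec_top)

lemma topspace_Spec_top: "topspace (Spec_top A) = points A"
proof
  show "topspace (Spec_top A) \<subseteq> points A"
  proof
    fix x assume "x \<in> topspace (Spec_top A)"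
    with openin_topspace[of "Spec_top A"] obtain a where "x \<in> basic_open A a"
      unfolding openin_Spec_top by blast
    then show "x \<in> points A" by (simp add: basic_open_def)
  qed
  have "openin (Spec_top A) (points A)"
    using openin_basic_open[OF AR.one_closed] by (simp add: basic_open_one)
  then show "points A \<subseteq> topspace (Spec_top A)" by (rule openin_subset)
qed

lemma openin_points: "openin (Spec_top A) (points A)"
  using openin_topspace[of "Spec_top A"] by (simp add: topspace_Spec_top)

lemma open_point: "\<lbrakk>openin (Spec_top A) U; x \<in> U\<rbrakk> \<Longrightarrow> cinf_point A x"
  using openin_subset[of "Spec_top A" U] topspace_Spec_top point by auto

end

section \<open>The structure sheaf\<close>

context cinf_ring
begin

text \<open>
  Working with a neighbourhood of each point is more convenient than with a cover; the next lemmas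
  and \<open>sectionI\<close> are the translation.
\<close>

lemma section_ext: "s \<in> carrier (Spec_sheaf A U) \<Longrightarrow> s \<in> extensional U"
  and section_value: "\<lbrakk>s \<in> carrier (Spec_sheaf A U); x \<in> U\<rbrakk> \<Longrightarrow> s x \<in> carrier (loc_at A x)"
  by (auto simp: Spec_sheaf_def PiE_iff)

lemma section_local:
  assumes s: "s \<in> carrier (Spec_sheaf A U)" and x: "x \<in> U"
  shows "\<exists>V a. openin (Spec_top A) V \<and> x \<in> V \<and> V \<subseteq> U \<and>
    a \<in> carrier A \<and> (\<forall>y\<in>V. s y = loc_map A y a)"
proof -
  from s obtain \<V> where "\<forall>V\<in>\<V>. openin (Spec_top A) V" and U: "\<Union>\<V> = U"
    and "\<forall>V\<in>\<V>. \<exists>a\<in>carrier A. \<forall>x\<in>V. s x = loc_map A x a"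
    by (auto simp: Spec_sheaf_def PiE_iff)
  moreover from x U obtain V where "V \<in> \<V>" "x \<in> V" by auto
  moreover from this U have "V \<subseteq> U" by auto
  ultimately show ?thesis by (intro exI[of _ V]) auto
qed

lemma sectionI:
  assumes U: "openin (Spec_top A) U" and ext: "s \<in> extensional U"
    and loc: "\<And>x. x \<in> U \<Longrightarrow> \<exists>V a. openin (Spec_top A) V \<and> x \<in> V \<and> V \<subseteq> U \<and>
      a \<in> carrier A \<and> (\<forall>y\<in>V. s y = loc_map A y a)"
  shows "s \<in> carrier (Spec_sheaf A U)"
proof -
  define \<V> where "\<V> = {V. openin (Spec_top A) V \<and> V \<subseteq> U \<and>
    (\<exists>a\<in>carrier A. \<forall>y\<in>V. s y = loc_map A y a)}"
  have "\<Union>\<V> = U"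
  proof
    show "\<Union>\<V> \<subseteq> U" by (auto simp: \<V>_def)
    show "U \<subseteq> \<Union>\<V>"
    proof
      fix x assume "x \<in> U"
      from loc[OF this] show "x \<in> \<Union>\<V>" unfolding \<V>_def by blast
    qed
  qed
  moreover have "\<forall>V\<in>\<V>. openin (Spec_top A) V" by (simp add: \<V>_def)
  moreover have "\<forall>V\<in>\<V>. \<exists>a\<in>carrier A. \<forall>y\<in>V. s y = loc_map A y a" by (simp add: \<V>_def)
  moreover have "s \<in> (\<Pi>\<^sub>E x\<in>U. carrier (loc_at A x))"
  proof (rule PiE_I)
    fix x assume x: "x \<in> U"
    interpret x: cinf_point A x by (rule open_point[OF U x])
    from loc[OF x] show "s x \<in> carrier (loc_at A x)" by auto
  next
    fix x assume "x \<notin> U"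
    with ext show "s x = undefined" by (rule extensional_arb)
  qed
  ultimately show ?thesis unfolding Spec_sheaf_def by auto
qed

text \<open>
  Operations take finitely many sections at once, so these must be represented on a common
  neighbourhood.
\<close>

lemma sections_local:
  assumes U: "openin (Spec_top A) U" and s: "\<And>i. i < n \<Longrightarrow> s i \<in> carrier (Spec_sheaf A U)"
    and x: "x \<in> U"
  obtains V a where "openin (Spec_top A) V" "x \<in> V" "V \<subseteq> U" "a \<in> tuples n A"
    "\<And>i y. \<lbrakk>i < n; y \<in> V\<rbrakk> \<Longrightarrow> s i y = loc_map A y (a i)"
proof -
  have "\<exists>V a. openin (Spec_top A) V \<and> x \<in> V \<and> V \<subseteq> U \<and> a \<in> tuples n A \<and>
      (\<forall>i<n. \<forall>y\<in>V. s i y = loc_map A y (a i))"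
    using s
  proof (induction n)
    case 0
    show ?case using U x by (intro exI[of _ U] exI[of _ "\<lambda>i. undefined"]) auto
  next
    case (Suc n)
    then obtain V a where V: "openin (Spec_top A) V" "x \<in> V" "V \<subseteq> U" "a \<in> tuples n A"
      and Va: "\<And>i y. \<lbrakk>i < n; y \<in> V\<rbrakk> \<Longrightarrow> s i y = loc_map A y (a i)" by force
    obtain W b where W: "openin (Spec_top A) W" "x \<in> W" "W \<subseteq> U" "b \<in> carrier A"
      and Wb: "\<And>y. y \<in> W \<Longrightarrow> s n y = loc_map A y b"
      using section_local[OF Suc.prems[of n] x] by auto
    have "a(n := b) \<in> tuples (Suc n) A" using V W by (auto simp: Pi_iff less_Suc_eq)
    moreover have "s i y = loc_map A y ((a(n := b)) i)" if "i < Suc n" "y \<in> V \<inter> W" for i y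
      using that Va Wb by (cases "i = n") auto
    ultimately show ?case
      using V W by (intro exI[of _ "V \<inter> W"] exI[of _ "a(n := b)"]) auto
  qed
  then show thesis using that by auto
qed

lemma Spec_sheaf_oper: "oper (Spec_sheaf A U) n f s = (\<lambda>x\<in>U. oper (loc_at A x) n f (\<lambda>i. s i x))"
  by (simp add: Spec_sheaf_def)

lemma section_cinf_ring:
  assumes U: "openin (Spec_top A) U"
  shows "cinf_ring (Spec_sheaf A U)"
proof -
  have ring: "cinf_ring (loc_at A x)" if "x \<in> U" for x
  proof -
    interpret x: cinf_point A x by (rule open_point[OF U that])
    show ?thesis by (rule x.loc.B.cinf_ring_axioms)
  qed
  have val: "(\<lambda>i. s i x) \<in> tuples n (loc_at A x)"
    if "s \<in> tuples n (Spec_sheaf A U)" "x \<in> U" for s n x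
    using that section_value by auto
  show ?thesis
  proof
    fix f n s assume f: "f \<in> Cinf n" and s: "s \<in> tuples n (Spec_sheaf A U)"
    show "oper (Spec_sheaf A U) n f s \<in> carrier (Spec_sheaf A U)"
    proof (rule sectionI[OF U])
      show "oper (Spec_sheaf A U) n f s \<in> extensional U" by (simp add: Spec_sheaf_oper)
      fix x assume x: "x \<in> U"
      obtain V a where V: "openin (Spec_top A) V" "x \<in> V" "V \<subseteq> U" and a: "a \<in> tuples n A"
        and sa: "\<And>i y. \<lbrakk>i < n; y \<in> V\<rbrakk> \<Longrightarrow> s i y = loc_map A y (a i)"
        using sections_local[OF U _ x, of n s] s by blast
      have "oper (Spec_sheaf A U) n f s y = loc_map A y (oper A n f a)" if y: "y \<in> V" for y
      proof -
        have yU: "y \<in> U" using y V by auto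
        interpret y: cinf_point A y by (rule open_point[OF U yU])
        have "oper (loc_at A y) n f (\<lambda>i. s i y) = oper (loc_at A y) n f (\<lambda>i. loc_map A y (a i))"
          using sa y by (intro y.loc.B.oper_cong[OF f val[OF s yU]]) auto
        then show ?thesis
          using yU y.loc.hom_oper[OF f a] by (simp add: Spec_sheaf_oper)
      qed
      with V oper_closed[OF f a] show "\<exists>V a. openin (Spec_top A) V \<and> x \<in> V \<and> V \<subseteq> U \<and>
          a \<in> carrier A \<and> (\<forall>y\<in>V. oper (Spec_sheaf A U) n f s y = loc_map A y a)"
        by (intro exI[of _ V] exI[of _ "oper A n f a"]) simp
    qed
    fix t assume "\<And>i. i < n \<Longrightarrow> s i = t i"
    then show "oper (Spec_sheaf A U) n f s = oper (Spec_sheaf A U) n f t"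
      unfolding Spec_sheaf_oper
      by (intro restrict_ext cinf_ring.oper_cong[OF ring f val[OF s]]) simp_all
  next
    fix i n s assume i: "i < n" and s: "s \<in> tuples n (Spec_sheaf A U)"
    have "oper (Spec_sheaf A U) n (\<lambda>v. v i) s = (\<lambda>x\<in>U. s i x)"
      unfolding Spec_sheaf_oper
      by (intro restrict_ext cinf_ring.oper_proj[OF ring i val[OF s]])
    also have "\<dots> = s i"
      using s i section_ext by (auto intro: extensional_restrict)
    finally show "oper (Spec_sheaf A U) n (\<lambda>v. v i) s = s i" .
  next
    fix f m g n s assume f: "f \<in> Cinf m" and g: "\<And>j. j < m \<Longrightarrow> g j \<in> Cinf n"
      and s: "s \<in> tuples n (Spec_sheaf A U)"
    show "oper (Spec_sheaf A U) n (\<lambda>v. f (\<lambda>j. g j v)) s =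
        oper (Spec_sheaf A U) m f (\<lambda>j. oper (Spec_sheaf A U) n (g j) s)"
      unfolding Spec_sheaf_oper
    proof (rule restrict_ext)
      fix x assume x: "x \<in> U"
      then show "oper (loc_at A x) n (\<lambda>v. f (\<lambda>j. g j v)) (\<lambda>i. s i x) =
          oper (loc_at A x) m f (\<lambda>j. (\<lambda>x\<in>U. oper (loc_at A x) n (g j) (\<lambda>i. s i x)) x)"
        using cinf_ring.oper_comp[OF ring[OF x] f g val[OF s x]] by simp
    qed
  qed
qed

lemma restrict_section:
  assumes s: "s \<in> carrier (Spec_sheaf A U)" and V: "openin (Spec_top A) V" "V \<subseteq> U"
  shows "restrict s V \<in> carrier (Spec_sheaf A V)"
proof (rule sectionI[OF V(1)])
  fix x assume x: "x \<in> V"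
  with V have "x \<in> U" by auto
  from section_local[OF s this]
  obtain W a where "openin (Spec_top A) W" "x \<in> W" "a \<in> carrier A" "\<forall>y\<in>W. s y = loc_map A y a"
    by auto
  with V x show "\<exists>W a. openin (Spec_top A) W \<and> x \<in> W \<and> W \<subseteq> V \<and> a \<in> carrier A \<and>
      (\<forall>y\<in>W. restrict s V y = loc_map A y a)"
    by (intro exI[of _ "W \<inter> V"] exI[of _ a]) auto
qed simp

lemma Spec_res: "s \<in> carrier (Spec_sheaf A U) \<Longrightarrow> Spec_res A U V s = restrict s V"
  by (simp add: Spec_res_def)

lemma Spec_res_hom:
  assumes U: "openin (Spec_top A) U" and V: "openin (Spec_top A) V" "V \<subseteq> U"
  shows "Spec_res A U V \<in> cinf_hom (Spec_sheaf A U) (Spec_sheaf A V)"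
proof -
  have "Spec_res A U V (oper (Spec_sheaf A U) n f s) =
      oper (Spec_sheaf A V) n f (\<lambda>i. Spec_res A U V (s i))"
    if f: "f \<in> Cinf n" and s: "s \<in> tuples n (Spec_sheaf A U)" for n f s
  proof -
    have si: "s i \<in> carrier (Spec_sheaf A U)" if "i < n" for i using s that by auto
    have "oper (Spec_sheaf A U) n f s \<in> carrier (Spec_sheaf A U)"
      by (rule cinf_ring.oper_closed[OF section_cinf_ring[OF U] f s])
    then have "Spec_res A U V (oper (Spec_sheaf A U) n f s) = oper (Spec_sheaf A V) n f (\<lambda>i. restrict (s i) V)"
      using V(2) by (auto simp: Spec_res Spec_sheaf_oper fun_eq_iff restrict_def)
    also have "\<dots> = oper (Spec_sheaf A V) n f (\<lambda>i. Spec_res A U V (s i))"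
      by (rule cinf_ring.oper_cong[OF section_cinf_ring[OF V(1)] f])
         (use V in \<open>auto simp: Spec_res[OF si] restrict_section[OF si]\<close>)
    finally show ?thesis .
  qed
  moreover have "Spec_res A U V \<in> carrier (Spec_sheaf A U) \<rightarrow>\<^sub>E carrier (Spec_sheaf A V)"
    using restrict_section V by (auto simp: Spec_res_def)
  ultimately show ?thesis by (simp add: cinf_hom_def)
qed

text \<open>
  The glued section takes at \<open>x\<close> the value of any \<open>\<sigma> V\<close> with \<open>x \<in> V\<close>; compatibility makes the choice
  irrelevant, so near \<open>x\<close> it coincides with one \<open>\<sigma> V\<close>.
\<close>

lemma Spec_glue:
  assumes opn: "\<And>V. V \<in> \<V> \<Longrightarrow> openin (Spec_top A) V"
    and \<sigma>: "\<And>V. V \<in> \<V> \<Longrightarrow> \<sigma> V \<in> carrier (Spec_sheaf A V)"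
    and compat: "\<And>V W. \<lbrakk>V \<in> \<V>; W \<in> \<V>\<rbrakk> \<Longrightarrow>
      Spec_res A V (V \<inter> W) (\<sigma> V) = Spec_res A W (V \<inter> W) (\<sigma> W)"
  shows "\<exists>!s. s \<in> carrier (Spec_sheaf A (\<Union>\<V>)) \<and> (\<forall>V\<in>\<V>. Spec_res A (\<Union>\<V>) V s = \<sigma> V)"
proof (rule ex_ex1I)
  have opU: "openin (Spec_top A) (\<Union>\<V>)" using opn by (rule openin_Union)
  have agree: "\<sigma> V x = \<sigma> W x" if "V \<in> \<V>" "W \<in> \<V>" "x \<in> V" "x \<in> W" for V W x
  proof -
    have "restrict (\<sigma> V) (V \<inter> W) x = restrict (\<sigma> W) (V \<inter> W) x"
      using compat[OF that(1,2)] Spec_res[OF \<sigma>[OF that(1)]] Spec_res[OF \<sigma>[OF that(2)]] by simp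
    with that show ?thesis by simp
  qed
  define s where "s = (\<lambda>x\<in>\<Union>\<V>. \<sigma> (SOME V. V \<in> \<V> \<and> x \<in> V) x)"
  have s: "s x = \<sigma> V x" if V: "V \<in> \<V>" "x \<in> V" for V x
  proof -
    have "(SOME V. V \<in> \<V> \<and> x \<in> V) \<in> \<V> \<and> x \<in> (SOME V. V \<in> \<V> \<and> x \<in> V)"
      by (rule someI_ex) (use V in blast)
    then have "\<sigma> (SOME V. V \<in> \<V> \<and> x \<in> V) x = \<sigma> V x"
      using V by (intro agree) auto
    moreover have "x \<in> \<Union>\<V>" using V by auto
    ultimately show ?thesis by (simp add: s_def)
  qed
  have sec: "s \<in> carrier (Spec_sheaf A (\<Union>\<V>))"
  proof (rule sectionI[OF opU])
    show "s \<in> extensional (\<Union>\<V>)" by (simp add: s_def)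
    fix x assume "x \<in> \<Union>\<V>"
    then obtain V where V: "V \<in> \<V>" "x \<in> V" by auto
    obtain W a where W: "openin (Spec_top A) W" "x \<in> W" "W \<subseteq> V" "a \<in> carrier A"
      "\<forall>y\<in>W. \<sigma> V y = loc_map A y a"
      using section_local[OF \<sigma>[OF V(1)] V(2)] by auto
    then have "s y = loc_map A y a" if "y \<in> W" for y
      using s[OF V(1), of y] that by auto
    with W V show "\<exists>W a. openin (Spec_top A) W \<and> x \<in> W \<and> W \<subseteq> \<Union>\<V> \<and> a \<in> carrier A \<and>
        (\<forall>y\<in>W. s y = loc_map A y a)"
      by (intro exI[of _ W] exI[of _ a]) auto
  qed
  have "Spec_res A (\<Union>\<V>) V s = \<sigma> V" if V: "V \<in> \<V>" for V
  proof -
    have "restrict s V = restrict (\<sigma> V) V" using s[OF V] by (intro restrict_ext) simp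
    also have "\<dots> = \<sigma> V" by (rule extensional_restrict[OF section_ext[OF \<sigma>[OF V]]])
    finally show ?thesis by (simp add: Spec_res[OF sec])
  qed
  with sec show "\<exists>s. s \<in> carrier (Spec_sheaf A (\<Union>\<V>)) \<and> (\<forall>V\<in>\<V>. Spec_res A (\<Union>\<V>) V s = \<sigma> V)"
    by (intro exI[of _ s]) simp
next
  fix s t
  assume s: "s \<in> carrier (Spec_sheaf A (\<Union>\<V>)) \<and> (\<forall>V\<in>\<V>. Spec_res A (\<Union>\<V>) V s = \<sigma> V)"
    and t: "t \<in> carrier (Spec_sheaf A (\<Union>\<V>)) \<and> (\<forall>V\<in>\<V>. Spec_res A (\<Union>\<V>) V t = \<sigma> V)"
  show "s = t"
  proof (rule extensionalityI)
    show "s \<in> extensional (\<Union>\<V>)" "t \<in> extensional (\<Union>\<V>)" using s t section_ext by simp_all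
    fix x assume "x \<in> \<Union>\<V>"
    then obtain V where V: "V \<in> \<V>" "x \<in> V" by auto
    have "restrict s V x = restrict t V x"
      using s t V(1) Spec_res[of s "\<Union>\<V>" V] Spec_res[of t "\<Union>\<V>" V] by simp
    with V show "s x = t x" by simp
  qed
qed

lemma Spec_cinf_sheaf: "cinf_sheaf (Spec_top A) (Spec_sheaf A) (Spec_res A)"
proof (rule cinf_sheaf.intro)
  show "Spec_res A U U s = s" if "s \<in> carrier (Spec_sheaf A U)" for U s
    using that by (simp add: Spec_res extensional_restrict[OF section_ext])
  show "Spec_res A V W (Spec_res A U V s) = Spec_res A U W s"
    if "openin (Spec_top A) V" "W \<subseteq> V" "V \<subseteq> U" "s \<in> carrier (Spec_sheaf A U)" for U V W s
    using that by (simp add: Spec_res restrict_section Int_absorb1)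
qed (rule section_cinf_ring Spec_res_hom Spec_glue; assumption)+

end

section \<open>Stalks\<close>

context cinf_ring
begin

text \<open>
  These are \<open>oper_closed\<close> and \<open>oper_cong\<close> for a composite, derived from \<open>oper_comp\<close> and thus without
  the chain rule that would be needed to see that the composite is smooth.
\<close>

lemma oper_comp_closed:
  assumes "f \<in> Cinf m" "\<And>j. j < m \<Longrightarrow> g j \<in> Cinf n" "a \<in> tuples n A"
  shows "oper A n (\<lambda>v. f (\<lambda>j. g j v)) a \<in> carrier A"
proof -
  have "(\<lambda>j. oper A n (g j) a) \<in> tuples m A" using oper_closed[OF assms(2,3)] by auto
  then show ?thesis using oper_comp[OF assms] oper_closed[OF assms(1)] by simp
qed

lemma oper_comp_cong:
  assumes f: "f \<in> Cinf m" and g: "\<And>j. j < m \<Longrightarrow> g j \<in> Cinf n"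
    and a: "a \<in> tuples n A" and ab: "\<And>i. i < n \<Longrightarrow> a i = b i"
  shows "oper A n (\<lambda>v. f (\<lambda>j. g j v)) a = oper A n (\<lambda>v. f (\<lambda>j. g j v)) b"
proof -
  have b: "b \<in> tuples n A" using a by (auto simp: Pi_iff ab[symmetric])
  have "(\<lambda>j. oper A n (g j) a) \<in> tuples m A" using oper_closed[OF g a] by auto
  then have "oper A m f (\<lambda>j. oper A n (g j) a) = oper A m f (\<lambda>j. oper A n (g j) b)"
    by (rule oper_cong[OF f]) (rule oper_cong[OF g a ab])
  then show ?thesis using oper_comp[OF f g a] oper_comp[OF f g b] by simp
qed

lemma Spec_section_is_section:
  "a \<in> carrier A \<Longrightarrow> Spec_section A a \<in> carrier (Spec_sheaf A (points A))"
proof (rule sectionI)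
  show "openin (Spec_top A) (points A)" by (rule openin_points)
  then show "\<exists>V b. openin (Spec_top A) V \<and> x \<in> V \<and> V \<subseteq> points A \<and> b \<in> carrier A \<and>
      (\<forall>y\<in>V. Spec_section A a y = loc_map A y b)" if "a \<in> carrier A" "x \<in> points A" for x
    using that by (intro exI[of _ "points A"] exI[of _ a]) (simp add: Spec_section_def)
qed (simp add: Spec_section_def)

end

text \<open>
  A point of \<open>B\<close> is determined by its pullback along \<open>\<phi>\<close>, which is a point of \<open>A\<close>.
\<close>

lemma local_cinf_ring_retract:
  assumes A: "local_cinf_ring A" and B: "cinf_ring B"
    and \<phi>: "\<phi> \<in> cinf_hom A B" and \<psi>: "\<psi> \<in> cinf_hom B A"
    and inv: "\<And>b. b \<in> carrier B \<Longrightarrow> \<phi> (\<psi> b) = b"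
  shows "local_cinf_ring B"
  unfolding local_cinf_ring_def
proof (intro conjI ex_ex1I)
  have A': "cinf_ring A" using A by (simp add: local_cinf_ring_def)
  obtain p where "p \<in> cinf_hom A real_cinf" using A by (auto simp: local_cinf_ring_def)
  from cinf_hom_compose[OF B real_cinf_ring \<psi> this]
  show "\<exists>p. p \<in> cinf_hom B real_cinf" by (intro exI)
  fix p q assume p: "p \<in> cinf_hom B real_cinf" and q: "q \<in> cinf_hom B real_cinf"
  obtain r where r: "\<And>r'. r' \<in> cinf_hom A real_cinf \<Longrightarrow> r' = r"
    using A by (auto simp: local_cinf_ring_def)
  have "(\<lambda>a\<in>carrier A. p (\<phi> a)) = (\<lambda>a\<in>carrier A. q (\<phi> a))"
    using r[OF cinf_hom_compose[OF A' real_cinf_ring \<phi> p]]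
      r[OF cinf_hom_compose[OF A' real_cinf_ring \<phi> q]] by (rule trans[OF _ sym])
  then have eq: "p (\<phi> a) = q (\<phi> a)" if "a \<in> carrier A" for a
    using that by (simp add: fun_eq_iff restrict_def split: if_splits)
  show "p = q"
  proof (rule cinf_hom_eqI[OF p q])
    fix b assume b: "b \<in> carrier B"
    show "p b = q b" using eq[OF cinf_hom_closed[OF \<psi> b]] by (simp add: inv[OF b])
  qed
qed (rule B)

context cinf_point
begin

definition germ_pairs :: "(('a \<Rightarrow> real) set \<times> (('a \<Rightarrow> real) \<Rightarrow> 'a set)) set" where
  "germ_pairs = {(U, s). openin (Spec_top A) U \<and> x \<in> U \<and> s \<in> carrier (Spec_sheaf A U)}"

text \<open>
  The germ with value \<open>l\<close> at \<open>x\<close>; by \<open>germ_rel_eq\<close> these sets are the equivalence classes that form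
  the stalk, so \<open>germ\<close> and \<open>germ_value\<close> are mutually inverse.
\<close>

definition germ :: "'a set \<Rightarrow> (('a \<Rightarrow> real) set \<times> (('a \<Rightarrow> real) \<Rightarrow> 'a set)) set" where
  "germ l = (if l \<in> carrier (loc_at A x) then {p \<in> germ_pairs. snd p x = l} else undefined)"

abbreviation Spec_stalk :: "(('a \<Rightarrow> real) set \<times> (('a \<Rightarrow> real) \<Rightarrow> 'a set)) set cinf_ring" where
  "Spec_stalk \<equiv> stalk (Spec_top A) (Spec_sheaf A) (Spec_res A) x"

definition germ_value :: "(('a \<Rightarrow> real) set \<times> (('a \<Rightarrow> real) \<Rightarrow> 'a set)) set \<Rightarrow> 'a set" where
  "germ_value \<gamma> = (if \<gamma> \<in> carrier Spec_stalk then snd (SOME p. p \<in> \<gamma>) x else undefined)"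

text \<open>
  Equality in \<open>A\<^sub>x\<close> is witnessed by some \<open>d\<close> with \<open>x d \<noteq> 0\<close>, and the same \<open>d\<close> witnesses equality in \<open>A\<^sub>y\<close>
  for all \<open>y\<close> with \<open>y d \<noteq> 0\<close>.
\<close>

lemma equal_values_locally_equal:
  assumes U: "openin (Spec_top A) U" "x \<in> U" "s \<in> carrier (Spec_sheaf A U)"
    and V: "openin (Spec_top A) V" "x \<in> V" "t \<in> carrier (Spec_sheaf A V)"
    and eq: "s x = t x"
  shows "\<exists>W. openin (Spec_top A) W \<and> x \<in> W \<and> W \<subseteq> U \<inter> V \<and> (\<forall>y\<in>W. s y = t y)"
proof -
  obtain U' a where U': "openin (Spec_top A) U'" "x \<in> U'" "U' \<subseteq> U" and a: "a \<in> carrier A"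
    and sa: "\<And>y. y \<in> U' \<Longrightarrow> s y = loc_map A y a"
    using section_local[OF U(3,2)] by auto
  obtain V' b where V': "openin (Spec_top A) V'" "x \<in> V'" "V' \<subseteq> V" and b: "b \<in> carrier A"
    and tb: "\<And>y. y \<in> V' \<Longrightarrow> t y = loc_map A y b"
    using section_local[OF V(3,2)] by auto
  have "loc_map A x a = loc_map A x b" using eq sa[OF U'(2)] tb[OF V'(2)] by simp
  then obtain d where d: "d \<in> carrier A" "x d \<noteq> 0" "a \<otimes>\<^bsub>alg A\<^esub> d = b \<otimes>\<^bsub>alg A\<^esub> d"
    using loc_map_eq_iff[OF a b] by auto
  have "s y = t y" if y: "y \<in> U' \<inter> V' \<inter> basic_open A d" for y
  proof -
    have "y \<in> points A" "y d \<noteq> 0" using y by (auto simp: basic_open_def)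
    then have "loc_map A y a = loc_map A y b"
      using cinf_point.loc_map_eq_iff[OF point a b] d by auto
    then show ?thesis using y sa tb by simp
  qed
  moreover have "x \<in> basic_open A d" using d x_point by (simp add: basic_open_def)
  ultimately show ?thesis
    using U' V' openin_basic_open[OF d(1)]
    by (intro exI[of _ "U' \<inter> V' \<inter> basic_open A d"]) auto
qed

lemma germ_rel_eq:
  "germ_rel (Spec_top A) (Spec_sheaf A) (Spec_res A) x =
    {(p, q). p \<in> germ_pairs \<and> q \<in> germ_pairs \<and> snd p x = snd q x}"
proof -
  have *: "(\<exists>W. openin (Spec_top A) W \<and> x \<in> W \<and> W \<subseteq> U \<inter> V \<and> Spec_res A U W s = Spec_res A V W t)
      \<longleftrightarrow> s x = t x"
    if U: "openin (Spec_top A) U" "x \<in> U" "s \<in> carrier (Spec_sheaf A U)"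
      and V: "openin (Spec_top A) V" "x \<in> V" "t \<in> carrier (Spec_sheaf A V)" for U V s t
  proof
    assume "\<exists>W. openin (Spec_top A) W \<and> x \<in> W \<and> W \<subseteq> U \<inter> V \<and> Spec_res A U W s = Spec_res A V W t"
    then obtain W where W: "x \<in> W" "restrict s W = restrict t W"
      by (auto simp: Spec_res[OF U(3)] Spec_res[OF V(3)])
    then have "restrict s W x = restrict t W x" by simp
    with W(1) show "s x = t x" by simp
  next
    assume "s x = t x"
    from equal_values_locally_equal[OF U V this]
    obtain W where W: "openin (Spec_top A) W" "x \<in> W" "W \<subseteq> U \<inter> V" "\<forall>y\<in>W. s y = t y" by auto
    then have "restrict s W = restrict t W" by (intro restrict_ext) simp
    with W show "\<exists>W. openin (Spec_top A) W \<and> x \<in> W \<and> W \<subseteq> U \<inter> V \<and>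
        Spec_res A U W s = Spec_res A V W t"
      by (auto simp: Spec_res[OF U(3)] Spec_res[OF V(3)])
  qed
  have "(p, q) \<in> germ_rel (Spec_top A) (Spec_sheaf A) (Spec_res A) x \<longleftrightarrow>
      p \<in> germ_pairs \<and> q \<in> germ_pairs \<and> snd p x = snd q x" for p q
  proof -
    obtain U s V t where pq: "p = (U, s)" "q = (V, t)" by (cases p, cases q)
    show ?thesis
      unfolding pq germ_rel_def germ_pairs_def mem_Collect_eq prod.case snd_conv
      using *[of U s V t] by argo
  qed
  then show ?thesis by (intro Set.set_eqI) (simp only: split_paired_all mem_Collect_eq prod.case)
qed

lemma germ_pairs_value: "p \<in> germ_pairs \<Longrightarrow> snd p x \<in> carrier (loc_at A x)"
  using section_value by (auto simp: germ_pairs_def)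

lemma germ_rel_Image:
  "p \<in> germ_pairs \<Longrightarrow> germ_rel (Spec_top A) (Spec_sheaf A) (Spec_res A) x `` {p} = germ (snd p x)"
  by (auto simp: germ_rel_eq germ_def germ_pairs_value)

lemma germ_nonempty:
  assumes "l \<in> carrier (loc_at A x)"
  shows "\<exists>p. p \<in> germ l"
proof -
  obtain a where a: "a \<in> carrier A" "l = loc_map A x a" using assms by (auto simp: loc_at_carrier)
  have "(points A, Spec_section A a) \<in> germ_pairs"
    using openin_points Spec_section_is_section[OF a(1)] x_point by (simp add: germ_pairs_def)
  moreover have "Spec_section A a x = l" using a x_point by (simp add: Spec_section_def)
  ultimately have "(points A, Spec_section A a) \<in> germ l" using assms by (simp add: germ_def)
  then show ?thesis by (rule exI)
qed

lemma carrier_Spec_stalk: "carrier Spec_stalk = germ ` carrier (loc_at A x)"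
proof -
  have "carrier Spec_stalk = germ_pairs // germ_rel (Spec_top A) (Spec_sheaf A) (Spec_res A) x"
    by (simp add: stalk_def germ_pairs_def)
  also have "\<dots> = (\<lambda>p. germ (snd p x)) ` germ_pairs"
    unfolding quotient_def using germ_rel_Image by auto
  also have "\<dots> = germ ` carrier (loc_at A x)"
  proof
    show "(\<lambda>p. germ (snd p x)) ` germ_pairs \<subseteq> germ ` carrier (loc_at A x)"
      using germ_pairs_value by auto
    show "germ ` carrier (loc_at A x) \<subseteq> (\<lambda>p. germ (snd p x)) ` germ_pairs"
    proof
      fix \<gamma> assume "\<gamma> \<in> germ ` carrier (loc_at A x)"
      then obtain l where l: "l \<in> carrier (loc_at A x)" "\<gamma> = germ l" by auto
      obtain p where "p \<in> germ l" using germ_nonempty[OF l(1)] by auto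
      with l have "p \<in> germ_pairs" "\<gamma> = germ (snd p x)" by (auto simp: germ_def)
      then show "\<gamma> \<in> (\<lambda>p. germ (snd p x)) ` germ_pairs" by simp
    qed
  qed
  finally show ?thesis .
qed

lemma germ_value_germ:
  assumes l: "l \<in> carrier (loc_at A x)"
  shows "germ_value (germ l) = l"
proof -
  have "(SOME p. p \<in> germ l) \<in> germ l" by (rule someI_ex[OF germ_nonempty[OF l]])
  with l show ?thesis by (simp add: germ_value_def carrier_Spec_stalk) (simp add: germ_def)
qed

lemma germ_germ_value:
  assumes "\<gamma> \<in> carrier Spec_stalk"
  shows "germ_value \<gamma> \<in> carrier (loc_at A x)" "germ (germ_value \<gamma>) = \<gamma>"
  using assms germ_value_germ by (auto simp: carrier_Spec_stalk)

lemma stalk_rep: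
  assumes "\<gamma> \<in> carrier Spec_stalk"
  shows "(SOME p. p \<in> \<gamma>) \<in> germ_pairs" "snd (SOME p. p \<in> \<gamma>) x = germ_value \<gamma>"
proof -
  obtain l where l: "l \<in> carrier (loc_at A x)" "\<gamma> = germ l" using assms by (auto simp: carrier_Spec_stalk)
  have "(SOME p. p \<in> germ l) \<in> germ l" by (rule someI_ex[OF germ_nonempty[OF l(1)]])
  with l show "(SOME p. p \<in> \<gamma>) \<in> germ_pairs" by (simp add: germ_def)
  show "snd (SOME p. p \<in> \<gamma>) x = germ_value \<gamma>" using assms by (simp add: germ_value_def)
qed

text \<open>
  Stated for composites since the axiom \<open>oper_comp\<close> of the stalk needs it in this form.
\<close>

lemma stalk_oper_comp:
  assumes f: "f \<in> Cinf m" and g: "\<And>j. j < m \<Longrightarrow> g j \<in> Cinf n" and \<gamma>: "\<gamma> \<in> tuples n Spec_stalk"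
  shows "oper Spec_stalk n (\<lambda>v. f (\<lambda>j. g j v)) \<gamma>
       = germ (oper (loc_at A x) n (\<lambda>v. f (\<lambda>j. g j v)) (\<lambda>i. germ_value (\<gamma> i)))"
proof -
  define r where "r = (\<lambda>i. SOME p. p \<in> \<gamma> i)"
  define W where "W = topspace (Spec_top A) \<inter> (\<Inter>i\<in>{..<n}. fst (r i))"
  define \<sigma> where "\<sigma> = (\<lambda>i. Spec_res A (fst (r i)) W (snd (r i)))"
  define h where "h = (\<lambda>v. f (\<lambda>j. g j v))"
  have r: "openin (Spec_top A) (fst (r i))" "x \<in> fst (r i)"
    "snd (r i) \<in> carrier (Spec_sheaf A (fst (r i)))" "snd (r i) x = germ_value (\<gamma> i)" if "i < n" for i
  proof -
    have "\<gamma> i \<in> carrier Spec_stalk" using \<gamma> that by auto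
    from stalk_rep[OF this] show "openin (Spec_top A) (fst (r i))" "x \<in> fst (r i)"
      "snd (r i) \<in> carrier (Spec_sheaf A (fst (r i)))" "snd (r i) x = germ_value (\<gamma> i)"
      by (auto simp: r_def germ_pairs_def case_prod_beta)
  qed
  have W_open: "openin (Spec_top A) W"
    unfolding W_def
  \<comment> \<open>An empty intersection of open sets is all of \<open>UNIV\<close>, which need not be open.\<close>
  proof (cases "n = 0")
    case False
    then have "openin (Spec_top A) (\<Inter>i\<in>{..<n}. fst (r i))"
      using r(1) by (intro openin_INT2) auto
    then show "openin (Spec_top A) (topspace (Spec_top A) \<inter> (\<Inter>i\<in>{..<n}. fst (r i)))"
      by (intro openin_Int openin_topspace)
  qed simp
  have xW: "x \<in> W" using r(2) x_point by (auto simp: W_def topspace_Spec_top)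
  have \<sigma>: "\<sigma> i \<in> carrier (Spec_sheaf A W)" "\<sigma> i x = germ_value (\<gamma> i)" if i: "i < n" for i
  proof -
    have "W \<subseteq> fst (r i)" using i by (auto simp: W_def)
    with r[OF i] W_open xW show "\<sigma> i \<in> carrier (Spec_sheaf A W)" "\<sigma> i x = germ_value (\<gamma> i)"
      by (auto simp: \<sigma>_def Spec_res restrict_section)
  qed
  interpret W: cinf_ring "Spec_sheaf A W" by (rule section_cinf_ring[OF W_open])
  have \<sigma>t: "\<sigma> \<in> tuples n (Spec_sheaf A W)" using \<sigma>(1) by auto
  have "oper (Spec_sheaf A W) n h \<sigma> \<in> carrier (Spec_sheaf A W)"
    unfolding h_def by (rule W.oper_comp_closed[OF f g \<sigma>t])
  then have pair: "(W, oper (Spec_sheaf A W) n h \<sigma>) \<in> germ_pairs"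
    using W_open xW by (simp add: germ_pairs_def)
  have "oper Spec_stalk n h \<gamma> =
      germ_rel (Spec_top A) (Spec_sheaf A) (Spec_res A) x `` {(W, oper (Spec_sheaf A W) n h \<sigma>)}"
    by (simp add: stalk_def Let_def r_def W_def \<sigma>_def)
  also have "\<dots> = germ (oper (Spec_sheaf A W) n h \<sigma> x)"
    using germ_rel_Image[OF pair] by simp
  also have "oper (Spec_sheaf A W) n h \<sigma> x = oper (loc_at A x) n h (\<lambda>i. \<sigma> i x)"
    using xW by (simp add: Spec_sheaf_oper)
  also have "\<dots> = oper (loc_at A x) n h (\<lambda>i. germ_value (\<gamma> i))"
    unfolding h_def
  proof (rule loc.B.oper_comp_cong[OF f g])
    show "(\<lambda>i. \<sigma> i x) \<in> tuples n (loc_at A x)" using section_value[OF \<sigma>(1) xW] by auto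
  qed (use \<sigma>(2) in auto)
  finally show ?thesis by (simp add: h_def)
qed

lemma stalk_oper:
  assumes f: "f \<in> Cinf n" and \<gamma>: "\<gamma> \<in> tuples n Spec_stalk"
  shows "oper Spec_stalk n f \<gamma> = germ (oper (loc_at A x) n f (\<lambda>i. germ_value (\<gamma> i)))"
  using stalk_oper_comp[OF f _ \<gamma>, of "\<lambda>j v. v j"] by simp

lemma germ_values: "\<gamma> \<in> tuples n Spec_stalk \<Longrightarrow> (\<lambda>i. germ_value (\<gamma> i)) \<in> tuples n (loc_at A x)"
  using germ_germ_value(1) by auto

lemma stalk_cinf_ring: "cinf_ring Spec_stalk"
proof
  fix f n \<gamma> assume f: "f \<in> Cinf n" and \<gamma>: "\<gamma> \<in> tuples n Spec_stalk"
  show "oper Spec_stalk n f \<gamma> \<in> carrier Spec_stalk"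
    using loc.B.oper_closed[OF f germ_values[OF \<gamma>]]
    by (simp add: stalk_oper[OF f \<gamma>] carrier_Spec_stalk)
  fix \<delta> assume eq: "\<And>i. i < n \<Longrightarrow> \<gamma> i = \<delta> i"
  have \<delta>: "\<delta> \<in> tuples n Spec_stalk" using \<gamma> by (auto simp: Pi_iff eq[symmetric])
  show "oper Spec_stalk n f \<gamma> = oper Spec_stalk n f \<delta>"
    unfolding stalk_oper[OF f \<gamma>] stalk_oper[OF f \<delta>]
    by (rule arg_cong[where f = germ], rule loc.B.oper_cong[OF f germ_values[OF \<gamma>]])
       (simp add: eq)
next
  fix i n \<gamma> assume i: "i < n" and \<gamma>: "\<gamma> \<in> tuples n Spec_stalk"
  have "\<gamma> i \<in> carrier Spec_stalk" using i \<gamma> by auto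
  then show "oper Spec_stalk n (\<lambda>v. v i) \<gamma> = \<gamma> i"
    using i by (simp add: stalk_oper[OF Cinf_proj[OF i] \<gamma>] loc.B.oper_proj[OF i germ_values[OF \<gamma>]]
        germ_germ_value)
next
  fix f m g n \<gamma>
  assume f: "f \<in> Cinf m" and g: "\<And>j. j < m \<Longrightarrow> g j \<in> Cinf n" and \<gamma>: "\<gamma> \<in> tuples n Spec_stalk"
  have gv: "oper (loc_at A x) n (g j) (\<lambda>i. germ_value (\<gamma> i)) \<in> carrier (loc_at A x)" if "j < m" for j
    by (rule loc.B.oper_closed[OF g[OF that] germ_values[OF \<gamma>]])
  have gj: "oper Spec_stalk n (g j) \<gamma> = germ (oper (loc_at A x) n (g j) (\<lambda>i. germ_value (\<gamma> i)))"
    if "j < m" for j by (rule stalk_oper[OF g[OF that] \<gamma>])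
  have gt: "(\<lambda>j. oper Spec_stalk n (g j) \<gamma>) \<in> tuples m Spec_stalk"
    using gv gj by (auto simp: carrier_Spec_stalk)
  have "oper (loc_at A x) n (\<lambda>v. f (\<lambda>j. g j v)) (\<lambda>i. germ_value (\<gamma> i)) =
      oper (loc_at A x) m f (\<lambda>j. oper (loc_at A x) n (g j) (\<lambda>i. germ_value (\<gamma> i)))"
    by (rule loc.B.oper_comp[OF f g germ_values[OF \<gamma>]])
  also have "\<dots> = oper (loc_at A x) m f (\<lambda>j. germ_value (oper Spec_stalk n (g j) \<gamma>))"
    using gv by (intro loc.B.oper_cong[OF f]) (auto simp: gj germ_value_germ)
  finally show "oper Spec_stalk n (\<lambda>v. f (\<lambda>j. g j v)) \<gamma> =
      oper Spec_stalk m f (\<lambda>j. oper Spec_stalk n (g j) \<gamma>)"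
    by (simp add: stalk_oper_comp[OF f g \<gamma>] stalk_oper[OF f gt])
qed

lemma germ_value_hom: "germ_value \<in> cinf_hom Spec_stalk (loc_at A x)"
proof -
  have "germ_value \<in> carrier Spec_stalk \<rightarrow>\<^sub>E carrier (loc_at A x)"
    using germ_germ_value(1) by (auto simp: germ_value_def[abs_def] simp del: snd_conv)
  moreover have "germ_value (oper Spec_stalk n f \<gamma>) = oper (loc_at A x) n f (\<lambda>i. germ_value (\<gamma> i))"
    if "f \<in> Cinf n" "\<gamma> \<in> tuples n Spec_stalk" for n f \<gamma>
    using that loc.B.oper_closed[OF that(1) germ_values[OF that(2)]]
    by (simp add: stalk_oper germ_value_germ)
  ultimately show ?thesis by (simp add: cinf_hom_def)
qed

lemma germ_hom: "germ \<in> cinf_hom (loc_at A x) Spec_stalk"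
proof -
  have "germ \<in> carrier (loc_at A x) \<rightarrow>\<^sub>E carrier Spec_stalk"
    by (rule PiE_I) (simp_all add: carrier_Spec_stalk germ_def)
  moreover have "germ (oper (loc_at A x) n f l) = oper Spec_stalk n f (\<lambda>i. germ (l i))"
    if f: "f \<in> Cinf n" and l: "l \<in> tuples n (loc_at A x)" for n f l
  proof -
    have "(\<lambda>i. germ (l i)) \<in> tuples n Spec_stalk" using l by (auto simp: carrier_Spec_stalk)
    moreover have "oper (loc_at A x) n f l = oper (loc_at A x) n f (\<lambda>i. germ_value (germ (l i)))"
    proof (rule loc.B.oper_cong[OF f l])
      fix i assume "i < n"
      then have "l i \<in> carrier (loc_at A x)" using l by auto
      then show "l i = germ_value (germ (l i))" by (rule germ_value_germ[symmetric])
    qed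
    ultimately show ?thesis by (simp add: stalk_oper[OF f])
  qed
  ultimately show ?thesis by (simp add: cinf_hom_def)
qed

lemma stalk_local: "local_cinf_ring Spec_stalk"
  using loc_at_local stalk_cinf_ring germ_hom germ_value_hom germ_germ_value(2)
  by (rule local_cinf_ring_retract)

end

lemma (in cinf_ring) Spec_local_cinf_ringed_space:
  "local_cinf_ringed_space (Spec_top A) (Spec_sheaf A) (Spec_res A)"
proof (intro local_cinf_ringed_space.intro Spec_cinf_sheaf local_cinf_ringed_space_axioms.intro)
  fix x assume "x \<in> topspace (Spec_top A)"
  then have "x \<in> points A" by (simp add: topspace_Spec_top)
  then show "local_cinf_ring (stalk (Spec_top A) (Spec_sheaf A) (Spec_res A) x)"
    by (intro cinf_point.stalk_local point)
qed

section \<open>Poisson brackets\<close>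

lemma poisson_quotient:
  assumes "poisson_cinf_ring A br" and \<phi>: "cinf_hom_pair A B \<phi>"
    and surj: "carrier B = \<phi> ` carrier A"
    and br': "\<And>a b. \<lbrakk>a \<in> carrier A; b \<in> carrier A\<rbrakk> \<Longrightarrow> br' (\<phi> a) (\<phi> b) = \<phi> (br a b)"
  shows "poisson_cinf_ring B br'"
proof -
  interpret A: poisson_cinf_ring A br by fact
  interpret \<phi>: cinf_hom_pair A B \<phi> by fact
  note [simp] = A.br_closed br' A.br_self \<phi>.hom_smult[symmetric] \<phi>.H.hom_mult[symmetric]
    \<phi>.H.hom_add[symmetric]
  note [simp del] = \<phi>.H.hom_mult \<phi>.H.hom_add \<phi>.H.hom_finsum
  have B: "\<exists>a\<in>carrier A. b = \<phi> a" if "b \<in> carrier B" for b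
    using that surj by auto
  show ?thesis
  proof (intro poisson_cinf_ring.intro poisson_cinf_ring_axioms.intro \<phi>.B.cinf_ring_axioms)
    fix b c assume "b \<in> carrier B" "c \<in> carrier B"
    then obtain b' c' where bc: "b' \<in> carrier A" "b = \<phi> b'" "c' \<in> carrier A" "c = \<phi> c'"
      using B by metis
    then show "br' b c \<in> carrier B" by simp
    show "br' (r \<odot>\<^bsub>alg B\<^esub> b) c = r \<odot>\<^bsub>alg B\<^esub> br' b c" "br' b (r \<odot>\<^bsub>alg B\<^esub> c) = r \<odot>\<^bsub>alg B\<^esub> br' b c" for r
      using bc A.br_smult_left A.br_smult_right by simp_all
  next
    fix b assume "b \<in> carrier B"
    then obtain b' where "b' \<in> carrier A" "b = \<phi> b'" using B by metis
    then show "br' b b = \<zero>\<^bsub>alg B\<^esub>" by simp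
  next
    fix b c d assume "b \<in> carrier B" "c \<in> carrier B" "d \<in> carrier B"
    then obtain b' c' d' where bcd: "b' \<in> carrier A" "b = \<phi> b'" "c' \<in> carrier A" "c = \<phi> c'"
      "d' \<in> carrier A" "d = \<phi> d'" using B by metis
    then show "br' (b \<oplus>\<^bsub>alg B\<^esub> c) d = br' b d \<oplus>\<^bsub>alg B\<^esub> br' c d"
      "br' b (c \<oplus>\<^bsub>alg B\<^esub> d) = br' b c \<oplus>\<^bsub>alg B\<^esub> br' b d"
      "br' b (br' c d) \<oplus>\<^bsub>alg B\<^esub> br' c (br' d b) \<oplus>\<^bsub>alg B\<^esub> br' d (br' b c) = \<zero>\<^bsub>alg B\<^esub>"
      "br' (b \<otimes>\<^bsub>alg B\<^esub> c) d = b \<otimes>\<^bsub>alg B\<^esub> br' c d \<oplus>\<^bsub>alg B\<^esub> br' b d \<otimes>\<^bsub>alg B\<^esub> c"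
      "br' b (c \<otimes>\<^bsub>alg B\<^esub> d) = c \<otimes>\<^bsub>alg B\<^esub> br' b d \<oplus>\<^bsub>alg B\<^esub> br' b c \<otimes>\<^bsub>alg B\<^esub> d"
      using A.br_add_left A.br_add_right A.br_jacobi A.br_leibniz_left A.br_leibniz_right
      by simp_all
  next
    fix n f b d assume n: "n > 0" and f: "f \<in> Cinf n" and b: "b \<in> carrier B" and d: "d \<in> tuples n B"
    obtain b' where b': "b' \<in> carrier A" "b = \<phi> b'" using B[OF b] by auto
    have "\<forall>i<n. \<exists>a\<in>carrier A. d i = \<phi> a" using B d by auto
    then obtain d' where d': "\<And>i. i < n \<Longrightarrow> d' i \<in> carrier A \<and> d i = \<phi> (d' i)" by metis
    then have d't: "d' \<in> tuples n A" by auto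
    have op: "oper B n h d = \<phi> (oper A n h d')" if "h \<in> Cinf n" for h
      using \<phi>.hom_oper[OF that d't] \<phi>.B.oper_cong[OF that d, of "\<lambda>i. \<phi> (d' i)"] d' by simp
    let ?t = "\<lambda>i. oper A n (partial i f) d' \<otimes>\<^bsub>alg A\<^esub> br b' (d' i)"
    have t: "?t \<in> tuples n A" using b' d' A.oper_closed[OF Cinf_partial[OF f] d't] by auto
    have "br' b (oper B n f d) = \<phi> (br b' (oper A n f d'))"
      using b' A.oper_closed[OF f d't] by (simp add: op[OF f])
    also have "\<dots> = \<phi> (\<Oplus>\<^bsub>alg A\<^esub>i\<in>{..<n}. ?t i)"
      by (simp only: A.br_cinf_derivation[OF n f b'(1) d't])
    also have "\<dots> = (\<Oplus>\<^bsub>alg B\<^esub>i\<in>{..<n}. (\<phi> \<circ> ?t) i)"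
      using \<phi>.H.hom_finsum[OF t] by simp
    also have "\<dots> = (\<Oplus>\<^bsub>alg B\<^esub>i\<in>{..<n}. oper B n (partial i f) d \<otimes>\<^bsub>alg B\<^esub> br' b (d i))"
    proof (rule \<phi>.B.AR.finsum_cong')
      show "(\<lambda>i. oper B n (partial i f) d \<otimes>\<^bsub>alg B\<^esub> br' b (d i)) \<in> tuples n B"
        using b' d' A.oper_closed[OF Cinf_partial[OF f] d't]
        by (auto simp: op[OF Cinf_partial[OF f]])
      show "(\<phi> \<circ> ?t) i = oper B n (partial i f) d \<otimes>\<^bsub>alg B\<^esub> br' b (d i)" if "i \<in> {..<n}" for i
        using that b' d'[of i] A.oper_closed[OF Cinf_partial[OF f] d't]
        by (simp add: op[OF Cinf_partial[OF f]])
    qed simp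
    finally show "br' b (oper B n f d) =
      (\<Oplus>\<^bsub>alg B\<^esub>i\<in>{..<n}. oper B n (partial i f) d \<otimes>\<^bsub>alg B\<^esub> br' b (d i))" .
  qed
qed

lemma poisson_subproduct:
  assumes B: "cinf_ring B"
    and C: "\<And>i. i \<in> I \<Longrightarrow> poisson_cinf_ring (C i) (brC i)"
    and e: "\<And>i. i \<in> I \<Longrightarrow> e i \<in> cinf_hom B (C i)"
    and inj: "\<And>b c. \<lbrakk>b \<in> carrier B; c \<in> carrier B; \<And>i. i \<in> I \<Longrightarrow> e i b = e i c\<rbrakk> \<Longrightarrow> b = c"
    and closed: "\<And>b c. \<lbrakk>b \<in> carrier B; c \<in> carrier B\<rbrakk> \<Longrightarrow> brB b c \<in> carrier B"
    and brB: "\<And>i b c. \<lbrakk>i \<in> I; b \<in> carrier B; c \<in> carrier B\<rbrakk> \<Longrightarrow> e i (brB b c) = brC i (e i b) (e i c)"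
  shows "poisson_cinf_ring B brB"
proof -
  interpret B: cinf_ring B by fact
  have pair: "cinf_hom_pair B (C i) (e i)" if "i \<in> I" for i
    using C[OF that] e[OF that]
    by (intro cinf_hom_pair.intro cinf_hom_pair_axioms.intro B) (simp add: poisson_cinf_ring_def)
  note [simp] = closed brB
  show ?thesis
  proof (intro poisson_cinf_ring.intro poisson_cinf_ring_axioms.intro B closed)
    fix b c :: 'a and r assume [simp]: "b \<in> carrier B" "c \<in> carrier B"
    show "brB (r \<odot>\<^bsub>alg B\<^esub> b) c = r \<odot>\<^bsub>alg B\<^esub> brB b c"
    proof (rule inj)
      fix i assume [simp]: "i \<in> I"
      interpret C: poisson_cinf_ring "C i" "brC i" by (rule C) simp
      interpret e: cinf_hom_pair B "C i" "e i" by (rule pair) simp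
      show "e i (brB (r \<odot>\<^bsub>alg B\<^esub> b) c) = e i (r \<odot>\<^bsub>alg B\<^esub> brB b c)"
        by (simp add: e.hom_smult C.br_smult_left)
    qed auto
    show "brB b (r \<odot>\<^bsub>alg B\<^esub> c) = r \<odot>\<^bsub>alg B\<^esub> brB b c"
    proof (rule inj)
      fix i assume [simp]: "i \<in> I"
      interpret C: poisson_cinf_ring "C i" "brC i" by (rule C) simp
      interpret e: cinf_hom_pair B "C i" "e i" by (rule pair) simp
      show "e i (brB b (r \<odot>\<^bsub>alg B\<^esub> c)) = e i (r \<odot>\<^bsub>alg B\<^esub> brB b c)"
        by (simp add: e.hom_smult C.br_smult_right)
    qed auto
  next
    fix b assume [simp]: "b \<in> carrier B"
    show "brB b b = \<zero>\<^bsub>alg B\<^esub>"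
    proof (rule inj)
      fix i assume [simp]: "i \<in> I"
      interpret C: poisson_cinf_ring "C i" "brC i" by (rule C) simp
      interpret e: cinf_hom_pair B "C i" "e i" by (rule pair) simp
      show "e i (brB b b) = e i \<zero>\<^bsub>alg B\<^esub>" by (simp add: C.br_self)
    qed auto
  next
    fix b c d assume [simp]: "b \<in> carrier B" "c \<in> carrier B" "d \<in> carrier B"
    have *: "e i (brB (b \<oplus>\<^bsub>alg B\<^esub> c) d) = e i (brB b d \<oplus>\<^bsub>alg B\<^esub> brB c d)"
      "e i (brB b (c \<oplus>\<^bsub>alg B\<^esub> d)) = e i (brB b c \<oplus>\<^bsub>alg B\<^esub> brB b d)"
      "e i (brB b (brB c d) \<oplus>\<^bsub>alg B\<^esub> brB c (brB d b) \<oplus>\<^bsub>alg B\<^esub> brB d (brB b c)) = e i \<zero>\<^bsub>alg B\<^esub>"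
      "e i (brB (b \<otimes>\<^bsub>alg B\<^esub> c) d) = e i (b \<otimes>\<^bsub>alg B\<^esub> brB c d \<oplus>\<^bsub>alg B\<^esub> brB b d \<otimes>\<^bsub>alg B\<^esub> c)"
      "e i (brB b (c \<otimes>\<^bsub>alg B\<^esub> d)) = e i (c \<otimes>\<^bsub>alg B\<^esub> brB b d \<oplus>\<^bsub>alg B\<^esub> brB b c \<otimes>\<^bsub>alg B\<^esub> d)"
      if [simp]: "i \<in> I" for i
    proof -
      interpret C: poisson_cinf_ring "C i" "brC i" by (rule C) simp
      interpret e: cinf_hom_pair B "C i" "e i" by (rule pair) simp
      show "e i (brB (b \<oplus>\<^bsub>alg B\<^esub> c) d) = e i (brB b d \<oplus>\<^bsub>alg B\<^esub> brB c d)"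
        by (simp add: C.br_add_left)
      show "e i (brB b (c \<oplus>\<^bsub>alg B\<^esub> d)) = e i (brB b c \<oplus>\<^bsub>alg B\<^esub> brB b d)"
        by (simp add: C.br_add_right)
      show "e i (brB b (brB c d) \<oplus>\<^bsub>alg B\<^esub> brB c (brB d b) \<oplus>\<^bsub>alg B\<^esub> brB d (brB b c)) = e i \<zero>\<^bsub>alg B\<^esub>"
        by (simp add: C.br_jacobi)
      show "e i (brB (b \<otimes>\<^bsub>alg B\<^esub> c) d) = e i (b \<otimes>\<^bsub>alg B\<^esub> brB c d \<oplus>\<^bsub>alg B\<^esub> brB b d \<otimes>\<^bsub>alg B\<^esub> c)"
        by (simp add: C.br_leibniz_left)
      show "e i (brB b (c \<otimes>\<^bsub>alg B\<^esub> d)) = e i (c \<otimes>\<^bsub>alg B\<^esub> brB b d \<oplus>\<^bsub>alg B\<^esub> brB b c \<otimes>\<^bsub>alg B\<^esub> d)"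
        by (simp add: C.br_leibniz_right)
    qed
    show "brB (b \<oplus>\<^bsub>alg B\<^esub> c) d = brB b d \<oplus>\<^bsub>alg B\<^esub> brB c d"
      by (rule inj[OF _ _ *(1)]) auto
    show "brB b (c \<oplus>\<^bsub>alg B\<^esub> d) = brB b c \<oplus>\<^bsub>alg B\<^esub> brB b d"
      by (rule inj[OF _ _ *(2)]) auto
    show "brB b (brB c d) \<oplus>\<^bsub>alg B\<^esub> brB c (brB d b) \<oplus>\<^bsub>alg B\<^esub> brB d (brB b c) = \<zero>\<^bsub>alg B\<^esub>"
      by (rule inj[OF _ _ *(3)]) auto
    show "brB (b \<otimes>\<^bsub>alg B\<^esub> c) d = b \<otimes>\<^bsub>alg B\<^esub> brB c d \<oplus>\<^bsub>alg B\<^esub> brB b d \<otimes>\<^bsub>alg B\<^esub> c"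
      by (rule inj[OF _ _ *(4)]) auto
    show "brB b (c \<otimes>\<^bsub>alg B\<^esub> d) = c \<otimes>\<^bsub>alg B\<^esub> brB b d \<oplus>\<^bsub>alg B\<^esub> brB b c \<otimes>\<^bsub>alg B\<^esub> d"
      by (rule inj[OF _ _ *(5)]) auto
  next
    fix n f b d
    assume n: "n > 0" and f: "f \<in> Cinf n" and b: "b \<in> carrier B" and d: "d \<in> tuples n B"
    let ?t = "\<lambda>j. oper B n (partial j f) d \<otimes>\<^bsub>alg B\<^esub> brB b (d j)"
    have dj: "d j \<in> carrier B" "oper B n (partial j f) d \<in> carrier B" if "j < n" for j
      using that d B.oper_closed[OF Cinf_partial[OF f that] d] by auto
    then have t: "?t \<in> tuples n B" using b by auto
    show "brB b (oper B n f d) = (\<Oplus>\<^bsub>alg B\<^esub>j\<in>{..<n}. ?t j)"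
    proof (rule inj)
      show "brB b (oper B n f d) \<in> carrier B" by (rule closed[OF b B.oper_closed[OF f d]])
      show "(\<Oplus>\<^bsub>alg B\<^esub>j\<in>{..<n}. ?t j) \<in> carrier B" using t by (rule B.AR.finsum_closed)
      fix i assume i: "i \<in> I"
      interpret C: poisson_cinf_ring "C i" "brC i" by (rule C[OF i])
      interpret e: cinf_hom_pair B "C i" "e i" by (rule pair[OF i])
      have ed: "(\<lambda>j. e i (d j)) \<in> tuples n (C i)" using dj by auto
      have "e i (brB b (oper B n f d)) = brC i (e i b) (oper (C i) n f (\<lambda>j. e i (d j)))"
        by (simp only: brB[OF i b B.oper_closed[OF f d]] e.hom_oper[OF f d])
      also have "\<dots> = (\<Oplus>\<^bsub>alg (C i)\<^esub>j\<in>{..<n}.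
          oper (C i) n (partial j f) (\<lambda>j. e i (d j)) \<otimes>\<^bsub>alg (C i)\<^esub> brC i (e i b) (e i (d j)))"
        by (rule C.br_cinf_derivation[OF n f e.closed[OF b] ed])
      also have "\<dots> = (\<Oplus>\<^bsub>alg (C i)\<^esub>j\<in>{..<n}. (e i \<circ> ?t) j)"
      proof (rule C.AR.finsum_cong')
        show "e i \<circ> ?t \<in> tuples n (C i)"
          by (rule Pi_I) (simp only: o_apply, rule e.closed, rule funcset_mem[OF t])
        show "oper (C i) n (partial j f) (\<lambda>j. e i (d j)) \<otimes>\<^bsub>alg (C i)\<^esub> brC i (e i b) (e i (d j))
            = (e i \<circ> ?t) j" if "j \<in> {..<n}" for j
          using that dj[of j] b i e.hom_oper[OF Cinf_partial[OF f] d, of j] by simp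
      qed simp
      also have "\<dots> = e i (\<Oplus>\<^bsub>alg B\<^esub>j\<in>{..<n}. ?t j)"
        using e.H.hom_finsum[OF t] by simp
      finally show "e i (brB b (oper B n f d)) = e i (\<Oplus>\<^bsub>alg B\<^esub>j\<in>{..<n}. ?t j)" .
    qed
  qed
qed

locale poisson_point = poisson_cinf_ring A br + cinf_point A x
  for A :: "'a cinf_ring" and br x
begin

text \<open>
  From \<open>a d = b d\<close>, expand \<open>{c, a d} d = {c, b d} d\<close> by the Leibniz rule and cancel the common term
  \<open>b d {c, d}\<close>. The factor that witnesses the equality of germs is \<open>d\<^sup>2\<close>.
\<close>

lemma bracket_germ_right:
  assumes "a \<in> carrier A" "b \<in> carrier A" "c \<in> carrier A"
    and eq: "loc_map A x a = loc_map A x b"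
  shows "loc_map A x (br c a) = loc_map A x (br c b)"
proof -
  from eq obtain d where d: "d \<in> carrier A" "x d \<noteq> 0" "a \<otimes>\<^bsub>alg A\<^esub> d = b \<otimes>\<^bsub>alg A\<^esub> d"
    using loc_map_eq_iff[OF assms(1,2)] by auto
  have bc: "br c a \<in> carrier A" "br c b \<in> carrier A" "br c d \<in> carrier A"
    using assms(1-3) d(1) by (simp_all add: br_closed)
  have leibniz: "br c (y \<otimes>\<^bsub>alg A\<^esub> d) \<otimes>\<^bsub>alg A\<^esub> d
      = y \<otimes>\<^bsub>alg A\<^esub> d \<otimes>\<^bsub>alg A\<^esub> br c d \<oplus>\<^bsub>alg A\<^esub> br c y \<otimes>\<^bsub>alg A\<^esub> (d \<otimes>\<^bsub>alg A\<^esub> d)"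
    if "y \<in> carrier A" "br c y \<in> carrier A" for y
    using that assms(3) d(1) bc(3)
    by (simp add: br_leibniz_right AR.l_distr AR.r_distr AR.m_ac AR.a_comm)
  have "b \<otimes>\<^bsub>alg A\<^esub> d \<otimes>\<^bsub>alg A\<^esub> br c d \<oplus>\<^bsub>alg A\<^esub> br c a \<otimes>\<^bsub>alg A\<^esub> (d \<otimes>\<^bsub>alg A\<^esub> d)
      = b \<otimes>\<^bsub>alg A\<^esub> d \<otimes>\<^bsub>alg A\<^esub> br c d \<oplus>\<^bsub>alg A\<^esub> br c b \<otimes>\<^bsub>alg A\<^esub> (d \<otimes>\<^bsub>alg A\<^esub> d)"
    using leibniz[OF assms(1) bc(1)] leibniz[OF assms(2) bc(2)] unfolding d(3)
    by (rule trans[OF sym])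
  then have "br c a \<otimes>\<^bsub>alg A\<^esub> (d \<otimes>\<^bsub>alg A\<^esub> d) = br c b \<otimes>\<^bsub>alg A\<^esub> (d \<otimes>\<^bsub>alg A\<^esub> d)"
    using assms(2) d(1) bc by simp
  moreover have "x (d \<otimes>\<^bsub>alg A\<^esub> d) \<noteq> 0" using d(1,2) by (simp add: x_mult)
  ultimately show ?thesis
    unfolding loc_map_eq_iff[OF bc(1,2)] using d(1)
    by (intro bexI[of _ "d \<otimes>\<^bsub>alg A\<^esub> d"] conjI AR.m_closed)
qed

text \<open>
  Carries the previous lemma over to the left argument.
\<close>

lemma br_swap:
  assumes "a \<in> carrier A" "b \<in> carrier A"
  shows "br a b = \<ominus>\<^bsub>alg A\<^esub> br b a"
proof -
  have c: "br a b \<in> carrier A" "br b a \<in> carrier A" using assms by (simp_all add: br_closed)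
  have "br (a \<oplus>\<^bsub>alg A\<^esub> b) (a \<oplus>\<^bsub>alg A\<^esub> b) = br a b \<oplus>\<^bsub>alg A\<^esub> br b a"
    using assms c by (simp add: br_add_left br_add_right br_self[of a] br_self[of b] AR.a_comm)
  moreover have "br (a \<oplus>\<^bsub>alg A\<^esub> b) (a \<oplus>\<^bsub>alg A\<^esub> b) = \<zero>\<^bsub>alg A\<^esub>"
    using assms by (intro br_self AR.a_closed)
  ultimately have "br a b \<oplus>\<^bsub>alg A\<^esub> br b a = \<zero>\<^bsub>alg A\<^esub>" by simp
  then show ?thesis using AR.minus_equality[of "br a b" "br b a"] c by simp
qed

lemma bracket_germ:
  assumes a: "a \<in> carrier A" "a' \<in> carrier A" "loc_map A x a = loc_map A x a'"
    and b: "b \<in> carrier A" "b' \<in> carrier A" "loc_map A x b = loc_map A x b'"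
  shows "loc_map A x (br a b) = loc_map A x (br a' b')"
proof -
  have "loc_map A x (br a b) = loc_map A x (br a b')"
    by (rule bracket_germ_right[OF b(1,2) a(1) b(3)])
  also have "\<dots> = loc_map A x (\<ominus>\<^bsub>alg A\<^esub> br b' a)" using br_swap[OF a(1) b(2)] by simp
  also have "\<dots> = loc_map A x (\<ominus>\<^bsub>alg A\<^esub> br b' a')"
    using bracket_germ_right[OF a(1,2) b(2) a(3)] a b br_closed by simp
  also have "\<dots> = loc_map A x (br a' b')" using br_swap[OF a(2) b(2)] by simp
  finally show ?thesis .
qed

definition loc_br :: "'a set \<Rightarrow> 'a set \<Rightarrow> 'a set" where
  "loc_br l m = loc_map A x (br (lift l) (lift m))"

lemma loc_br_loc_map:
  assumes "a \<in> carrier A" "b \<in> carrier A"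
  shows "loc_br (loc_map A x a) (loc_map A x b) = loc_map A x (br a b)"
  unfolding loc_br_def
  using lift[OF loc.closed[OF assms(1)]] lift[OF loc.closed[OF assms(2)]] assms
  by (elim conjE) (rule bracket_germ)

lemma loc_at_poisson: "poisson_cinf_ring (loc_at A x) loc_br"
  by (rule poisson_quotient[where \<phi> = "loc_map A x" and br' = loc_br,
        OF poisson_cinf_ring_axioms loc.cinf_hom_pair_axioms loc_at_carrier])
     (rule loc_br_loc_map)

end

context poisson_cinf_ring
begin

lemma poisson_point: "\<lbrakk>openin (Spec_top A) U; x \<in> U\<rbrakk> \<Longrightarrow> poisson_point A br x"
  by (intro poisson_point.intro poisson_cinf_ring_axioms open_point)

definition Spec_br ::
    "('a \<Rightarrow> real) set \<Rightarrow> (('a \<Rightarrow> real) \<Rightarrow> 'a set) \<Rightarrow> (('a \<Rightarrow> real) \<Rightarrow> 'a set) \<Rightarrow> ('a \<Rightarrow> real) \<Rightarrow> 'a set" where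
  "Spec_br U s t = (\<lambda>y\<in>U. poisson_point.loc_br A br y (s y) (t y))"

text \<open>
  Where \<open>s = \<s>\<^sub>a\<close> and \<open>t = \<s>\<^sub>b\<close>, the pointwise bracket is \<open>\<s>\<^bsub>{a, b}\<^esub>\<close>.
\<close>

lemma Spec_br_closed:
  assumes U: "openin (Spec_top A) U"
    and s: "s \<in> carrier (Spec_sheaf A U)" and t: "t \<in> carrier (Spec_sheaf A U)"
  shows "Spec_br U s t \<in> carrier (Spec_sheaf A U)"
proof (rule sectionI[OF U])
  fix x assume x: "x \<in> U"
  obtain V a where V: "openin (Spec_top A) V" "x \<in> V" "V \<subseteq> U" and a: "a \<in> carrier A"
    and sa: "\<And>y. y \<in> V \<Longrightarrow> s y = loc_map A y a" using section_local[OF s x] by auto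
  obtain W b where W: "openin (Spec_top A) W" "x \<in> W" "W \<subseteq> U" and b: "b \<in> carrier A"
    and tb: "\<And>y. y \<in> W \<Longrightarrow> t y = loc_map A y b" using section_local[OF t x] by auto
  have "Spec_br U s t y = loc_map A y (br a b)" if y: "y \<in> V \<inter> W" for y
  proof -
    have "poisson_point A br y" using y V by (intro poisson_point[OF V(1)]) auto
    with y V sa tb show ?thesis
      by (auto simp: Spec_br_def poisson_point.loc_br_loc_map[OF _ a b])
  qed
  with V W br_closed[OF a b] show "\<exists>V a. openin (Spec_top A) V \<and> x \<in> V \<and> V \<subseteq> U \<and>
      a \<in> carrier A \<and> (\<forall>y\<in>V. Spec_br U s t y = loc_map A y a)"
    by (intro exI[of _ "V \<inter> W"] exI[of _ "br a b"]) auto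
qed (simp add: Spec_br_def)

lemma section_eval_hom:
  assumes U: "openin (Spec_top A) U" and x: "x \<in> U"
  shows "(\<lambda>s\<in>carrier (Spec_sheaf A U). s x) \<in> cinf_hom (Spec_sheaf A U) (loc_at A x)"
proof -
  interpret F: cinf_ring "Spec_sheaf A U" by (rule section_cinf_ring[OF U])
  interpret x: cinf_point A x by (rule open_point[OF U x])
  have "oper (Spec_sheaf A U) n f s x =
      oper (loc_at A x) n f (\<lambda>i. (\<lambda>s\<in>carrier (Spec_sheaf A U). s x) (s i))"
    if f: "f \<in> Cinf n" and s: "s \<in> tuples n (Spec_sheaf A U)" for n f s
  proof -
    have si: "s i \<in> carrier (Spec_sheaf A U)" if "i < n" for i using s that by auto
    have "oper (Spec_sheaf A U) n f s x = oper (loc_at A x) n f (\<lambda>i. s i x)"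
      using x by (simp add: Spec_sheaf_oper)
    also have "\<dots> = oper (loc_at A x) n f (\<lambda>i. (\<lambda>s\<in>carrier (Spec_sheaf A U). s x) (s i))"
      using section_value[OF si x] si by (intro x.loc.B.oper_cong[OF f]) auto
    finally show ?thesis .
  qed
  then show ?thesis
    using section_value[OF _ x] F.oper_closed unfolding cinf_hom_def by simp
qed

text \<open>
  A section is determined by its values, so the evaluations embed the sections into a product of
  Poisson \<open>C\<^sup>\<infinity>\<close>-rings.
\<close>

lemma section_poisson:
  assumes U: "openin (Spec_top A) U"
  shows "poisson_cinf_ring (Spec_sheaf A U) (Spec_br U)"
proof (rule poisson_subproduct)
  show "cinf_ring (Spec_sheaf A U)" by (rule section_cinf_ring[OF U])
  show "poisson_cinf_ring (loc_at A x) (poisson_point.loc_br A br x)" if "x \<in> U" for x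
    by (rule poisson_point.loc_at_poisson[OF poisson_point[OF U that]])
  show "(\<lambda>s\<in>carrier (Spec_sheaf A U). s x) \<in> cinf_hom (Spec_sheaf A U) (loc_at A x)" if "x \<in> U" for x
    by (rule section_eval_hom[OF U that])
  show br: "Spec_br U s t \<in> carrier (Spec_sheaf A U)"
    if "s \<in> carrier (Spec_sheaf A U)" "t \<in> carrier (Spec_sheaf A U)" for s t
    by (rule Spec_br_closed[OF U that])
  show "(\<lambda>s\<in>carrier (Spec_sheaf A U). s x) (Spec_br U s t) = poisson_point.loc_br A br x
      ((\<lambda>s\<in>carrier (Spec_sheaf A U). s x) s) ((\<lambda>s\<in>carrier (Spec_sheaf A U). s x) t)"
    if "x \<in> U" "s \<in> carrier (Spec_sheaf A U)" "t \<in> carrier (Spec_sheaf A U)" for x s t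
    using that br by (simp add: Spec_br_def)
  fix s t assume st: "s \<in> carrier (Spec_sheaf A U)" "t \<in> carrier (Spec_sheaf A U)"
    and "\<And>x. x \<in> U \<Longrightarrow> (\<lambda>s\<in>carrier (Spec_sheaf A U). s x) s = (\<lambda>s\<in>carrier (Spec_sheaf A U). s x) t"
  then show "s = t"
    by (intro extensionalityI[OF section_ext section_ext]) auto
qed

lemma Spec_poisson_sheaf: "poisson_cinf_sheaf (Spec_top A) (Spec_sheaf A) (Spec_res A) Spec_br"
proof (intro poisson_cinf_sheaf.intro poisson_cinf_sheaf_axioms.intro Spec_cinf_sheaf section_poisson)
  fix U V assume U: "openin (Spec_top A) U" and V: "openin (Spec_top A) V" "V \<subseteq> U"
  have "Spec_res A U V (Spec_br U s t) = Spec_br V (Spec_res A U V s) (Spec_res A U V t)"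
    if "s \<in> carrier (Spec_sheaf A U)" "t \<in> carrier (Spec_sheaf A U)" for s t
    using that Spec_br_closed[OF U that] V(2)
    by (auto simp: Spec_res Spec_br_def fun_eq_iff restrict_def)
  then show "Spec_res A U V \<in> poisson_hom (Spec_sheaf A U) (Spec_br U) (Spec_sheaf A V) (Spec_br V)"
    using Spec_res_hom[OF U V] by (simp add: poisson_hom_def)
qed

lemma Spec_br_induced: "induced_poisson_structure A br Spec_br"
proof -
  let ?X = "points A" and ?\<phi> = "\<lambda>a\<in>carrier A. Spec_section A a"
  have X: "openin (Spec_top A) ?X" by (rule openin_points)
  interpret F: cinf_ring "Spec_sheaf A ?X" by (rule section_cinf_ring[OF X])
  have hom: "?\<phi> (oper A n f a) = oper (Spec_sheaf A ?X) n f (\<lambda>i. ?\<phi> (a i))"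
    if f: "f \<in> Cinf n" and a: "a \<in> tuples n A" for n f a
  proof -
    have "?\<phi> (oper A n f a) = (\<lambda>x\<in>?X. loc_map A x (oper A n f a))"
      using oper_closed[OF f a] by (simp add: Spec_section_def)
    also have "\<dots> = (\<lambda>x\<in>?X. oper (loc_at A x) n f (\<lambda>i. ?\<phi> (a i) x))"
    proof (rule restrict_ext)
      fix x assume x: "x \<in> ?X"
      interpret x: cinf_point A x by (rule point[OF x])
      have "loc_map A x (oper A n f a) = oper (loc_at A x) n f (\<lambda>i. loc_map A x (a i))"
        by (rule x.loc.hom_oper[OF f a])
      also have "\<dots> = oper (loc_at A x) n f (\<lambda>i. ?\<phi> (a i) x)"
        using a x by (intro x.loc.B.oper_cong[OF f]) (auto simp: Spec_section_def)
      finally show "loc_map A x (oper A n f a) = oper (loc_at A x) n f (\<lambda>i. ?\<phi> (a i) x)" .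
    qed
    finally show ?thesis by (simp add: Spec_sheaf_oper)
  qed
  have "?\<phi> (br a b) = Spec_br ?X (?\<phi> a) (?\<phi> b)" if ab: "a \<in> carrier A" "b \<in> carrier A" for a b
  proof -
    have "Spec_section A (br a b) = Spec_br ?X (Spec_section A a) (Spec_section A b)"
      unfolding Spec_section_def Spec_br_def
      using poisson_point.loc_br_loc_map[OF poisson_point[OF X] ab]
      by (intro restrict_ext) simp
    with ab br_closed show ?thesis by simp
  qed
  moreover have "?\<phi> \<in> cinf_hom A (Spec_sheaf A ?X)"
    using Spec_section_is_section hom unfolding cinf_hom_def by simp
  ultimately show ?thesis by (simp add: induced_poisson_structure_def poisson_hom_def)
qed

end

section \<open>The spectrum of a Poisson \<open>C\<^sup>\<infinity>\<close>-ring\<close>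

theorem theorem3p18:
  fixes A :: "'a cinf_ring" and br :: "'a \<Rightarrow> 'a \<Rightarrow> 'a"
  assumes "poisson_cinf_ring A br"
  shows "local_cinf_ringed_space (Spec_top A) (Spec_sheaf A) (Spec_res A) \<and>
    (\<exists>Br. poisson_cinf_sheaf (Spec_top A) (Spec_sheaf A) (Spec_res A) Br \<and>
          induced_poisson_structure A br Br)"
proof -
  interpret poisson_cinf_ring A br by fact
  show ?thesis
    using Spec_local_cinf_ringed_space Spec_poisson_sheaf Spec_br_induced by auto
qed

end
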